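(* Let the symmetric matrix $C\in\mathbb R^{n\times n}$ be positive definite and let $A\in\mathbb R^{m\times n}$, $m<n$, have full row rank. Then the self-concordant barrier $$\zeta(y)=-\ln\det(C-A^TD(y)A),\qquad D(y)=\mathrm{Diag}(y),\ y\in\mathbb R^m,$$ has the representation $$\zeta(y)=-\ln\det(G^{-1}-D(y))-\ln(\sigma\gamma),$$ where $G=AC^{-1}A^T$, $\sigma=\det C$ and $\gamma=\det G$. For its domain $\mathrm{dom}\,\zeta=\{y\in\mathbb R^m: D(y)\prec G^{-1}\}$, the barrier parameter has the best possible value $\nu_\zeta=m$; that is, $\zeta$ is a self-concordant barrier with parameter $m$ and no self-concordant barrier with this domain has a smaller parameter.
   Context: A self-concordant function is a closed convex three times differentiable function $f$ with open domain such that $D^3f(x)[h]^3\le2(D^2f(x)[h]^2)^{3/2}$ for all $x\in\mathrm{dom}\,f$ and all directions $h$. It is a self-concordant barrier with parameter $\nu$ (for the closure of its domain) if $\langle\nabla f(x),h\rangle^2\le\nu\langle\nabla^2f(x)h,h\rangle$ for all $x\in\mathrm{dom}\,f$ and all $h$. The natural domain of $\zeta$ is $\{y: C-A^TD(y)A\succ0\}$. *)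

theory Defs
  imports "HOL-Analysis.Analysis"
begin

definition pos_def :: "real^'n^'n \<Rightarrow> bool" where
  "pos_def M \<longleftrightarrow> transpose M = M \<and> (\<forall>x. x \<noteq> 0 \<longrightarrow> 0 < x \<bullet> (M *v x))"

(* The strict Loewner order. *)
definition loewner_less :: "real^'n^'n \<Rightarrow> real^'n^'n \<Rightarrow> bool"  (infix "\<prec>\<^sub>L" 50) where
  "X \<prec>\<^sub>L Y \<longleftrightarrow> pos_def (Y - X)"

definition Diag :: "real^'m \<Rightarrow> real^'m^'m" where
  "Diag y = (\<chi> i j. if i = j then y $ i else 0)"

(* The Frechet derivative as a bounded linear map, so that it can be differentiated again.
   It is meaningful only where f is differentiable. *)
definition fderiv ::
  "('a::real_normed_vector \<Rightarrow> 'b::real_normed_vector) \<Rightarrow> 'a \<Rightarrow> 'a \<Rightarrow>\<^sub>L 'b" where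
  "fderiv f x = Blinfun (frechet_derivative f (at x))"

definition three_times_differentiable_on ::
  "'a::real_normed_vector set \<Rightarrow> ('a \<Rightarrow> 'b::real_normed_vector) \<Rightarrow> bool" where
  "three_times_differentiable_on S f \<longleftrightarrow>
     (\<forall>x\<in>S. f differentiable at x \<and> fderiv f differentiable at x \<and>
            fderiv (fderiv f) differentiable at x)"

(* With the standard inner product, D1 f x h is the pairing of the gradient of f at x with h,
   and D2 f x h is the quadratic form of the Hessian of f at x, evaluated at h. *)
definition D1 :: "('a::real_normed_vector \<Rightarrow> real) \<Rightarrow> 'a \<Rightarrow> 'a \<Rightarrow> real" where
  "D1 f x h = blinfun_apply (fderiv f x) h"

definition D2 :: "('a::real_normed_vector \<Rightarrow> real) \<Rightarrow> 'a \<Rightarrow> 'a \<Rightarrow> real" where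
  "D2 f x h = blinfun_apply (blinfun_apply (fderiv (fderiv f) x) h) h"

definition D3 :: "('a::real_normed_vector \<Rightarrow> real) \<Rightarrow> 'a \<Rightarrow> 'a \<Rightarrow> real" where
  "D3 f x h =
     blinfun_apply (blinfun_apply (blinfun_apply (fderiv (fderiv (fderiv f)) x) h) h) h"

(* A function with domain S is a total function together with the set S; its values off S are
   irrelevant (S is open, so this also holds for the derivatives at points of S).
   It is closed if its epigraph is. The powr is harmless: convexity makes D2 nonnegative,
   and 0 powr (3/2) = 0. *)
definition self_concordant :: "'a::euclidean_space set \<Rightarrow> ('a \<Rightarrow> real) \<Rightarrow> bool" where
  "self_concordant S f \<longleftrightarrow>
     open S \<and> convex_on S f \<and> closed (epigraph S f) \<and> three_times_differentiable_on S f \<and>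
     (\<forall>x\<in>S. \<forall>h. D3 f x h \<le> 2 * (D2 f x h) powr (3/2))"

definition self_concordant_barrier ::
  "'a::euclidean_space set \<Rightarrow> ('a \<Rightarrow> real) \<Rightarrow> real \<Rightarrow> bool" where
  "self_concordant_barrier S f \<nu> \<longleftrightarrow>
     self_concordant S f \<and> (\<forall>x\<in>S. \<forall>h. (D1 f x h)\<^sup>2 \<le> \<nu> * D2 f x h)"

definition zeta :: "real^'n^'n \<Rightarrow> real^'n^'m \<Rightarrow> real^'m \<Rightarrow> real" where
  "zeta C A y = - ln (det (C - transpose A ** Diag y ** A))"

definition dom_zeta :: "real^'n^'n \<Rightarrow> real^'n^'m \<Rightarrow> (real^'m) set" where
  "dom_zeta C A = {y. pos_def (C - transpose A ** Diag y ** A)}"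

end

theory Submission
  imports Defs
begin

text \<open>
Write \<open>K(y) = C - A\<^sup>T D(y) A\<close> and \<open>V(y) = A K(y)\<^sup>-\<^sup>1 A\<^sup>T\<close>.
Jacobi's formula gives \<open>D\<zeta>(y)[h] = tr (V D(h))\<close>, and differentiating the inverse gives
\<open>DV(y)[h] = V D(h) V\<close>. So the first three derivatives of \<open>\<zeta>\<close> along \<open>h\<close> are \<open>tr (V D(h))\<close>,
\<open>tr ((V D(h))\<^sup>2)\<close> and \<open>2 tr ((V D(h))\<^sup>3)\<close>. Factor the positive semidefinite \<open>m \<times> m\<close> matrix \<open>V\<close>
as \<open>R\<^sup>T R\<close> with \<open>R\<close> square; then these are \<open>tr X\<close>, \<open>tr X\<^sup>2\<close>, \<open>2 tr X\<^sup>3\<close> for the symmetric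
\<open>X = R D(h) R\<^sup>T\<close>, and the Cauchy-Schwarz inequality for the Frobenius inner product yields
self-concordance and the parameter \<open>m = tr I\<close> (\<open>zeta_self_concordant_barrier\<close>).

For the representation, completing the square in \<open>z \<bullet> C z\<close> along
\<open>A z = x\<close> leaves \<open>x \<bullet> G\<^sup>-\<^sup>1 x\<close>, so \<open>K(y)\<close> is positive definite exactly when \<open>G\<^sup>-\<^sup>1 - D(y)\<close> is.
Moreover \<open>V(y) = (G\<^sup>-\<^sup>1 - D(y))\<^sup>-\<^sup>1\<close> (Woodbury), so \<open>\<zeta>\<close> and \<open>- ln det (G\<^sup>-\<^sup>1 - D(y))\<close>, which is the function
\<open>\<zeta>\<close> for the data \<open>G\<^sup>-\<^sup>1\<close> and \<open>I\<close>, have the same gradient on a convex set and differ by a constant;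
its value is read off at \<open>y = 0\<close> (\<open>zeta_reduction\<close>).

Optimality is a general property of barriers (\<open>barrier_parameter_lower_bound\<close>), due to Nesterov and Nemirovskii:
if from \<open>x\<close> the directions \<open>- p\<^sub>i\<close> are recession directions, \<open>x + \<beta>\<^sub>i p\<^sub>i\<close> lies outside the domain and
\<open>x + (\<Sum>i. \<alpha>\<^sub>i p\<^sub>i)\<close> inside, then \<open>\<nu> \<ge> (\<Sum>i. \<alpha>\<^sub>i / \<beta>\<^sub>i)\<close>. Here \<open>p\<^sub>i\<close> are the unit vectors,
\<open>x = (-t, \<dots>, -t)\<close>, \<open>\<alpha>\<^sub>i = t\<close> and \<open>\<beta>\<^sub>i = t + (G\<^sup>-\<^sup>1)\<^sub>i\<^sub>i\<close>; the bound tends to \<open>m\<close> as \<open>t \<longlongrightarrow> \<infinity>\<close>.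
\<close>

section \<open>Derivatives along lines\<close>

lemma has_derivative_fderiv:
  assumes "f differentiable at x"
  shows "(f has_derivative blinfun_apply (fderiv f x)) (at x)"
proof -
  have "(f has_derivative frechet_derivative f (at x)) (at x)"
    using assms frechet_derivative_works by blast
  moreover from this have "bounded_linear (frechet_derivative f (at x))"
    by (rule has_derivative_bounded_linear)
  ultimately show ?thesis
    by (simp add: fderiv_def bounded_linear_Blinfun_apply)
qed

lemma blinfun_apply_fderiv_eq:
  assumes "(f has_derivative f') (at x)"
  shows "blinfun_apply (fderiv f x) = f'"
  using assms has_derivative_fderiv has_derivative_unique
  by (metis differentiable_def)

lemma has_derivative_along_line:
  fixes f :: "'a::real_normed_vector \<Rightarrow> 'b::real_normed_vector"
  assumes "f differentiable at (x + t *\<^sub>R h)"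
  shows "((\<lambda>t. f (x + t *\<^sub>R h)) has_derivative
           (\<lambda>s. s *\<^sub>R blinfun_apply (fderiv f (x + t *\<^sub>R h)) h)) (at t)"
proof -
  have "((\<lambda>t. x + t *\<^sub>R h) has_derivative (\<lambda>s. s *\<^sub>R h)) (at t)"
    by (auto intro!: derivative_eq_intros)
  from diff_chain_at[OF this has_derivative_fderiv[OF assms]]
  show ?thesis by (simp add: o_def blinfun.scaleR_right)
qed

lemma DERIV_along_line:
  fixes f :: "'a::real_normed_vector \<Rightarrow> real"
  assumes "three_times_differentiable_on S f" "x + t *\<^sub>R h \<in> S"
  shows "DERIV (\<lambda>t. f (x + t *\<^sub>R h)) t :> D1 f (x + t *\<^sub>R h) h"
    and "DERIV (\<lambda>t. D1 f (x + t *\<^sub>R h) h) t :> D2 f (x + t *\<^sub>R h) h"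
    and "DERIV (\<lambda>t. D2 f (x + t *\<^sub>R h) h) t :> D3 f (x + t *\<^sub>R h) h"
proof -
  note d = assms(1)[unfolded three_times_differentiable_on_def, rule_format, OF assms(2)]
  note e = has_derivative_along_line[OF conjunct1[OF d]]
    has_derivative_along_line[OF conjunct1[OF conjunct2[OF d]]]
    has_derivative_along_line[OF conjunct2[OF conjunct2[OF d]]]
  have ap: "((\<lambda>t. blinfun_apply (g t) h) has_derivative (\<lambda>s. blinfun_apply (g' s) h)) (at t)"
    if "(g has_derivative g') (at t)" for g :: "real \<Rightarrow> 'a \<Rightarrow>\<^sub>L 'c::real_normed_vector" and g'
    using that by (auto intro!: derivative_eq_intros)
  show "DERIV (\<lambda>t. f (x + t *\<^sub>R h)) t :> D1 f (x + t *\<^sub>R h) h"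
    using e(1) unfolding has_field_derivative_def D1_def
    by (simp add: mult.commute[of _ "blinfun_apply _ _"])
  show "DERIV (\<lambda>t. D1 f (x + t *\<^sub>R h) h) t :> D2 f (x + t *\<^sub>R h) h"
    using ap[OF e(2)] unfolding has_field_derivative_def D1_def D2_def
    by (simp add: blinfun.scaleR_left mult.commute[of _ "blinfun_apply _ _"])
  show "DERIV (\<lambda>t. D2 f (x + t *\<^sub>R h) h) t :> D3 f (x + t *\<^sub>R h) h"
    using ap[OF ap[OF e(3)]] unfolding has_field_derivative_def D2_def D3_def
    by (simp add: blinfun.scaleR_left mult.commute[of _ "blinfun_apply _ _"])
qed

lemma D1_scaleR: "D1 f x (c *\<^sub>R h) = c * D1 f x h"
  and D2_uminus: "D2 f x (- h) = D2 f x h"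
  by (simp_all add: D1_def D2_def blinfun.bilinear_simps)

lemma D1_sum: "D1 f x (\<Sum>i\<in>I. h i) = (\<Sum>i\<in>I. D1 f x (h i))"
  by (simp add: D1_def blinfun.sum_right)

lemma line_in_convex:
  fixes x :: "'a::real_vector"
  assumes "convex S" "x \<in> S" "x + T *\<^sub>R h \<in> S" "0 \<le> t" "t \<le> T"
  shows "x + t *\<^sub>R h \<in> S"
proof (cases "T = 0")
  case False
  have "(1 - t/T) *\<^sub>R x + (t/T) *\<^sub>R (x + T *\<^sub>R h) \<in> S"
    using assms False by (intro convexD) auto
  then show ?thesis using False by (simp add: algebra_simps)
qed (use assms in auto)

text \<open>
Along a line the tangent inequalities at two points make the first derivative nondecreasing,
which is incompatible with a negative second derivative.
\<close>

lemma convex_on_D2_nonneg: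
  assumes "open S" "convex_on S f" "three_times_differentiable_on S f" "x \<in> S"
  shows "0 \<le> D2 f x h"
proof (rule ccontr)
  assume neg: "\<not> 0 \<le> D2 f x h"
  define T where "T = {t. x + t *\<^sub>R h \<in> S}"
  define \<phi> where "\<phi> = (\<lambda>t. f (x + t *\<^sub>R h))"
  have in_S: "x + t *\<^sub>R h \<in> S" if "t \<in> T" for t
    using that by (simp add: T_def)
  have T_vimage: "T = (\<lambda>t. x + t *\<^sub>R h) -` S" by (auto simp: T_def)
  have "open T"
    unfolding T_vimage using \<open>open S\<close>
    by (intro open_vimage) (auto intro!: continuous_intros)
  have "0 \<in> T" using assms by (simp add: T_def)
  have convex_\<phi>: "convex_on T \<phi>"
  proof -
    have aff: "x + (u * s + v * t) *\<^sub>R h = u *\<^sub>R (x + s *\<^sub>R h) + v *\<^sub>R (x + t *\<^sub>R h)"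
      if "u + v = 1" for u v s t :: real
    proof -
      have "u *\<^sub>R (x + s *\<^sub>R h) + v *\<^sub>R (x + t *\<^sub>R h) = (u + v) *\<^sub>R x + (u * s + v * t) *\<^sub>R h"
        by (simp add: algebra_simps)
      then show ?thesis using that by simp
    qed
    then show ?thesis
      using \<open>convex_on S f\<close> unfolding convex_on_def convex_def T_def \<phi>_def by simp
  qed
  have mono: "D1 f (x + s *\<^sub>R h) h \<le> D1 f (x + t *\<^sub>R h) h"
    if "s \<in> T" "t \<in> T" "s < t" for s t
  proof -
    have tangent: "D1 f (x + c *\<^sub>R h) h * (r - c) \<le> \<phi> r - \<phi> c" if "c \<in> T" "r \<in> T" for c r
    proof (rule convex_on_imp_above_tangent[OF convex_\<phi>])
      show "connected T" using convex_\<phi> convex_connected convex_on_imp_convex by blast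
      show "c \<in> interior T" using \<open>open T\<close> that by (simp add: interior_open)
      show "(\<phi> has_real_derivative D1 f (x + c *\<^sub>R h) h) (at c within T)"
        unfolding \<phi>_def using DERIV_along_line(1)[OF assms(3) in_S] that
        by (auto intro: has_field_derivative_at_within)
    qed (use that in auto)
    from tangent[of s t] tangent[of t s] that
    have "(D1 f (x + s *\<^sub>R h) h - D1 f (x + t *\<^sub>R h) h) * (t - s) \<le> 0"
      by (simp add: algebra_simps)
    then show ?thesis using that by (simp add: mult_le_0_iff)
  qed
  obtain d where "d > 0" and d: "\<And>r. 0 < r \<Longrightarrow> r < d \<Longrightarrow> D1 f (x + r *\<^sub>R h) h < D1 f x h"
    using DERIV_neg_dec_right[OF DERIV_along_line(2)[OF assms(3), of x 0 h]] neg assms(4) by auto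
  obtain e where "e > 0" and e: "ball 0 e \<subseteq> T"
    using \<open>open T\<close> \<open>0 \<in> T\<close> openE by blast
  define r where "r = min d e / 2"
  have "0 < r" "r < d" "r \<in> T" using \<open>d > 0\<close> \<open>e > 0\<close> e by (auto simp: r_def subset_iff)
  then show False using d[of r] mono[of 0 r] \<open>0 \<in> T\<close> by simp
qed

lemma convex_on_if_D2_nonneg:
  fixes f :: "'a::real_normed_vector \<Rightarrow> real"
  assumes "convex S" "three_times_differentiable_on S f"
    and nn: "\<And>x h. x \<in> S \<Longrightarrow> 0 \<le> D2 f x h"
  shows "convex_on S f"
  unfolding convex_on_def
proof (intro conjI ballI allI impI)
  fix x y :: 'a and u v :: real assume *: "x \<in> S" "y \<in> S" "0 \<le> u" "0 \<le> v" "u + v = 1"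
  define \<phi> where "\<phi> = (\<lambda>t. f (x + t *\<^sub>R (y - x)))"
  have in_S: "x + t *\<^sub>R (y - x) \<in> S" if "t \<in> {0..1}" for t
    using line_in_convex[OF assms(1) *(1), of 1 "y - x" t] * that by simp
  have "convex_on {0..1} \<phi>"
    unfolding \<phi>_def
    by (rule f''_ge0_imp_convex[where f' = "\<lambda>t. D1 f (x + t *\<^sub>R (y - x)) (y - x)"
          and f'' = "\<lambda>t. D2 f (x + t *\<^sub>R (y - x)) (y - x)"])
       (use DERIV_along_line[OF assms(2) in_S] nn[OF in_S] in auto)
  then have "\<phi> (u *\<^sub>R 0 + v *\<^sub>R 1) \<le> u * \<phi> 0 + v * \<phi> 1"
    using * unfolding convex_on_def by fastforce
  moreover have "x + v *\<^sub>R (y - x) = u *\<^sub>R x + v *\<^sub>R y"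
    using *(5) by (simp add: algebra_simps flip: scaleR_add_left)
  ultimately show "f (u *\<^sub>R x + v *\<^sub>R y) \<le> u * f x + v * f y"
    by (simp add: \<phi>_def)
qed fact

section \<open>Lower bounds for the barrier parameter\<close>

lemma DERIV_bound_imp_growth:
  fixes g :: "real \<Rightarrow> real"
  assumes "0 \<le> t" and "\<And>s. 0 \<le> s \<Longrightarrow> s \<le> t \<Longrightarrow> DERIV g s :> g' s"
    and "\<And>s. 0 \<le> s \<Longrightarrow> s \<le> t \<Longrightarrow> g' s \<le> K"
  shows "g t \<le> g 0 + K * t"
proof -
  have "g t - K * t \<le> g 0 - K * 0"
  proof (rule DERIV_nonpos_imp_nonincreasing[OF \<open>0 \<le> t\<close>])
    fix s assume s: "0 \<le> s" "s \<le> t"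
    have "DERIV (\<lambda>s. g s - K * s) s :> g' s - K"
      using assms(2)[OF s] by (auto intro!: derivative_eq_intros)
    then show "\<exists>y. DERIV (\<lambda>s. g s - K * s) s :> y \<and> y \<le> 0"
      using assms(3)[OF s] by auto
  qed
  then show ?thesis by simp
qed

lemma self_concordant_D2_nonneg:
  assumes "self_concordant S f" "x \<in> S"
  shows "0 \<le> D2 f x h"
  using assms convex_on_D2_nonneg unfolding self_concordant_def by blast

text \<open>
The function \<open>(D2 f + \<epsilon>) powr (-1/2)\<close> decreases at rate at most 1 along the line, because its
derivative is \<open>- D3 f / 2 * (D2 f + \<epsilon>) powr (-3/2)\<close>. The shift by \<open>\<epsilon>\<close> keeps it differentiable
where the second derivative vanishes.
\<close>

lemma self_concordant_D2_growth:
  assumes sc: "self_concordant S f" and "0 < \<epsilon>" "0 \<le> t"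
    and in_S: "\<And>s. 0 \<le> s \<Longrightarrow> s \<le> t \<Longrightarrow> x + s *\<^sub>R h \<in> S"
  shows "(D2 f x h + \<epsilon>) powr (-1/2) - t \<le> (D2 f (x + t *\<^sub>R h) h + \<epsilon>) powr (-1/2)"
proof -
  let ?q = "\<lambda>s. D2 f (x + s *\<^sub>R h) h"
  let ?c = "\<lambda>s. D3 f (x + s *\<^sub>R h) h"
  have diff: "three_times_differentiable_on S f" using sc by (simp add: self_concordant_def)
  have "- ((?q t + \<epsilon>) powr (-1/2)) \<le> - ((?q 0 + \<epsilon>) powr (-1/2)) + 1 * t"
  proof (rule DERIV_bound_imp_growth[where g = "\<lambda>s. - ((?q s + \<epsilon>) powr (-1/2))", OF \<open>0 \<le> t\<close>])
    fix s assume s: "0 \<le> s" "s \<le> t"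
    have q: "0 \<le> ?q s" using self_concordant_D2_nonneg[OF sc in_S[OF s]] .
    show "DERIV (\<lambda>s. - ((?q s + \<epsilon>) powr (-1/2))) s :> (?q s + \<epsilon>) powr (-3/2) * ?c s / 2"
    proof -
      have "DERIV (\<lambda>u. u powr (-1/2)) (?q s + \<epsilon>) :> (-1/2) * (?q s + \<epsilon>) powr (-1/2 - 1)"
        using q \<open>0 < \<epsilon>\<close> by (intro has_real_derivative_powr) auto
      moreover have "DERIV (\<lambda>s. ?q s + \<epsilon>) s :> ?c s"
        using DERIV_along_line(3)[OF diff in_S[OF s]] by (auto intro!: derivative_eq_intros)
      ultimately have "DERIV (\<lambda>s. (?q s + \<epsilon>) powr (-1/2)) s
          :> (-1/2) * (?q s + \<epsilon>) powr (-1/2 - 1) * ?c s"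
        by (rule DERIV_chain2)
      from DERIV_minus[OF this] show ?thesis by simp
    qed
    have "?c s \<le> 2 * ?q s powr (3/2)"
      using sc in_S[OF s] by (simp add: self_concordant_def)
    also have "\<dots> \<le> 2 * (?q s + \<epsilon>) powr (3/2)"
      using q \<open>0 < \<epsilon>\<close> by (intro mult_left_mono powr_mono2) auto
    finally have "(?q s + \<epsilon>) powr (-3/2) * ?c s
        \<le> (?q s + \<epsilon>) powr (-3/2) * (2 * (?q s + \<epsilon>) powr (3/2))"
      by (intro mult_left_mono) auto
    also have "\<dots> = 2 * (?q s + \<epsilon>) powr (-3/2 + 3/2)"
      by (simp only: powr_add)
    also have "\<dots> = 2" using q \<open>0 < \<epsilon>\<close> by simp
    finally show "(?q s + \<epsilon>) powr (-3/2) * ?c s / 2 \<le> 1" by simp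
  qed
  then show ?thesis by simp
qed

text \<open>
The Dikin ellipsoid lies in the domain. If \<open>D2 f x h\<close> were smaller than \<open>1 / \<beta>\<^sup>2\<close>, the growth bound
would keep the second derivative, hence also the first derivative and \<open>f\<close> itself, bounded up to
the first exit point from \<open>S\<close>; since the epigraph is closed, that point would lie in \<open>S\<close>.
\<close>

lemma self_concordant_D2_ge_if_exit:
  assumes sc: "self_concordant S f" and "x \<in> S" "0 < \<beta>" "x + \<beta> *\<^sub>R h \<notin> S"
  shows "1 / \<beta>\<^sup>2 \<le> D2 f x h"
proof (rule ccontr)
  assume "\<not> 1 / \<beta>\<^sup>2 \<le> D2 f x h"
  then have less: "D2 f x h < 1 / \<beta>\<^sup>2" by simp
  have "open S" and diff: "three_times_differentiable_on S f" and epi: "closed (epigraph S f)"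
    using sc by (auto simp: self_concordant_def)
  \<comment> \<open>the times up to \<open>\<beta>\<close> outside the domain; the least of them is the first exit time\<close>
  define Z where "Z = {0..\<beta>} \<inter> (\<lambda>t. x + t *\<^sub>R h) -` (- S)"
  have "compact Z" unfolding Z_def
    using \<open>open S\<close> by (intro compact_Int_closed closed_vimage) (auto intro!: continuous_intros)
  moreover have "\<beta> \<in> Z" using assms by (simp add: Z_def)
  ultimately obtain b where "b \<in> Z" and b_min: "\<And>t. t \<in> Z \<Longrightarrow> b \<le> t"
    using compact_attains_inf by (metis empty_iff)
  have "b \<le> \<beta>" "x + b *\<^sub>R h \<notin> S" "0 < b"
    using \<open>b \<in> Z\<close> \<open>x \<in> S\<close> by (auto simp: Z_def order_less_le)
  have in_S: "x + t *\<^sub>R h \<in> S" if "0 \<le> t" "t < b" for t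
    using b_min[of t] that \<open>b \<le> \<beta>\<close> by (auto simp: Z_def)
  \<comment> \<open>any \<open>\<epsilon>\<close> that keeps \<open>D2 f x h + \<epsilon>\<close> strictly below \<open>1 / \<beta>\<^sup>2\<close>\<close>
  define \<epsilon> where "\<epsilon> = (1 / \<beta>\<^sup>2 - D2 f x h) / 2"
  have "0 < \<epsilon>" using less by (simp add: \<epsilon>_def)
  have q0: "0 \<le> D2 f x h" using self_concordant_D2_nonneg[OF sc \<open>x \<in> S\<close>] .
  define \<delta> where "\<delta> = (D2 f x h + \<epsilon>) powr (-1/2) - b"
  have "(1 / \<beta>\<^sup>2) powr (-1/2) < (D2 f x h + \<epsilon>) powr (-1/2)"
    using less q0 \<open>0 < \<epsilon>\<close> by (intro powr_less_mono2_neg) (auto simp: \<epsilon>_def field_simps)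
  moreover have "(1 / \<beta>\<^sup>2) powr (-1/2) = \<beta>"
    using \<open>0 < \<beta>\<close> by (simp add: powr_minus powr_half_sqrt real_sqrt_divide)
  ultimately have "0 < \<delta>" using \<open>b \<le> \<beta>\<close> by (simp add: \<delta>_def)
  have q_bound: "D2 f (x + t *\<^sub>R h) h \<le> 1 / \<delta>\<^sup>2" if t: "0 \<le> t" "t < b" for t
  proof -
    let ?q = "D2 f (x + t *\<^sub>R h) h + \<epsilon>"
    have "0 < ?q" using self_concordant_D2_nonneg[OF sc in_S[OF t], of h] \<open>0 < \<epsilon>\<close> by simp
    have "\<delta> \<le> ?q powr (-1/2)"
      using self_concordant_D2_growth[OF sc \<open>0 < \<epsilon>\<close> t(1), of x h] in_S t by (force simp: \<delta>_def)
    also have "\<dots> = 1 / sqrt ?q"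
      using \<open>0 < ?q\<close> by (simp add: powr_minus powr_half_sqrt field_simps)
    finally have "\<delta> * sqrt ?q \<le> 1" using \<open>0 < ?q\<close> by (simp add: field_simps)
    then have "(\<delta> * sqrt ?q)\<^sup>2 \<le> 1\<^sup>2"
      using \<open>0 < \<delta>\<close> \<open>0 < ?q\<close> by (intro power_mono) auto
    then have "\<delta>\<^sup>2 * ?q \<le> 1" using \<open>0 < ?q\<close> by (simp add: power_mult_distrib)
    then have "?q \<le> 1 / \<delta>\<^sup>2" using \<open>0 < \<delta>\<close> by (simp add: field_simps)
    then show ?thesis using \<open>0 < \<epsilon>\<close> by simp
  qed
  define L where "L = \<bar>D1 f x h\<bar> + b / \<delta>\<^sup>2"
  have slope: "D1 f (x + t *\<^sub>R h) h \<le> L" if t: "0 \<le> t" "t < b" for t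
  proof -
    have "D1 f (x + t *\<^sub>R h) h \<le> D1 f (x + 0 *\<^sub>R h) h + 1 / \<delta>\<^sup>2 * t"
      using t q_bound in_S DERIV_along_line(2)[OF diff]
      by (intro DERIV_bound_imp_growth[where g = "\<lambda>t. D1 f (x + t *\<^sub>R h) h"
            and g' = "\<lambda>t. D2 f (x + t *\<^sub>R h) h"]) auto
    also have "\<dots> \<le> L" using t \<open>0 < \<delta>\<close> by (auto simp: L_def intro!: add_mono divide_right_mono)
    finally show ?thesis .
  qed
  have "0 \<le> L" using \<open>0 < b\<close> by (simp add: L_def)
  have val: "f (x + t *\<^sub>R h) \<le> f x + L * b" if t: "0 \<le> t" "t < b" for t
  proof -
    have "f (x + t *\<^sub>R h) \<le> f (x + 0 *\<^sub>R h) + L * t"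
      using t slope in_S DERIV_along_line(1)[OF diff]
      by (intro DERIV_bound_imp_growth[where g = "\<lambda>t. f (x + t *\<^sub>R h)"
            and g' = "\<lambda>t. D1 f (x + t *\<^sub>R h) h"]) auto
    also have "\<dots> \<le> f x + L * b" using t \<open>0 \<le> L\<close> by (auto intro!: mult_left_mono)
    finally show ?thesis .
  qed
  have "(x + b *\<^sub>R h, f x + L * b) \<in> epigraph S f"
  proof (rule Lim_in_closed_set[OF epi, where F = "at_left b"])
    show "\<forall>\<^sub>F t in at_left b. (x + t *\<^sub>R h, f x + L * b) \<in> epigraph S f"
      using eventually_at_left_real[OF \<open>0 < b\<close>]
      by eventually_elim (use in_S val in \<open>auto simp: epigraph_def\<close>)
    show "((\<lambda>t. (x + t *\<^sub>R h, f x + L * b)) \<longlongrightarrow> (x + b *\<^sub>R h, f x + L * b)) (at_left b)"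
      by (intro tendsto_intros)
  qed auto
  then show False using \<open>x + b *\<^sub>R h \<notin> S\<close> by (simp add: epigraph_def)
qed

text \<open>
Along the segment from \<open>x\<close> to \<open>y\<close> the barrier inequality says that the reciprocal of the first derivative
decreases at rate at least \<open>1 / \<nu>\<close>; it stays positive up to \<open>y\<close>, so it starts above \<open>1 / \<nu>\<close>.
\<close>

lemma barrier_D1_le:
  assumes bar: "self_concordant_barrier S f \<nu>" and "x \<in> S" "y \<in> S" "0 < D1 f x (y - x)"
  shows "D1 f x (y - x) \<le> \<nu>"
proof -
  define h where "h = y - x"
  let ?p = "\<lambda>t. D1 f (x + t *\<^sub>R h) h"
  let ?q = "\<lambda>t. D2 f (x + t *\<^sub>R h) h"
  have sc: "self_concordant S f" using bar by (simp add: self_concordant_barrier_def)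
  have "convex S" and diff: "three_times_differentiable_on S f"
    using sc convex_on_imp_convex by (auto simp: self_concordant_def)
  have in_S: "x + t *\<^sub>R h \<in> S" if "0 \<le> t" "t \<le> 1" for t
    using line_in_convex[OF \<open>convex S\<close> \<open>x \<in> S\<close>, of 1 h t] \<open>y \<in> S\<close> that by (simp add: h_def)
  have q_nonneg: "0 \<le> ?q t" if "0 \<le> t" "t \<le> 1" for t
    using self_concordant_D2_nonneg[OF sc in_S[OF that]] .
  have pq: "(?p t)\<^sup>2 \<le> \<nu> * ?q t" if "0 \<le> t" "t \<le> 1" for t
    using bar in_S[OF that] by (simp add: self_concordant_barrier_def)
  have p0: "0 < ?p 0" using assms by (simp add: h_def)
  have p_pos: "0 < ?p t" if t: "0 \<le> t" "t \<le> 1" for t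
  proof -
    have "- ?p t \<le> - ?p 0 + 0 * t"
      using t in_S q_nonneg
      by (intro DERIV_bound_imp_growth[where g = "\<lambda>t. - ?p t" and g' = "\<lambda>t. - ?q t"]
            DERIV_minus DERIV_along_line(2)[OF diff]) auto
    then show ?thesis using p0 by simp
  qed
  have "0 < \<nu> * ?q 0" using pq[of 0] p0 by (smt (verit) zero_less_power)
  then have "0 < \<nu>" using q_nonneg[of 0] by (simp add: zero_less_mult_iff)
  have "1 / ?p 1 \<le> 1 / ?p 0 + (- (1 / \<nu>)) * 1"
  proof (rule DERIV_bound_imp_growth[where g = "\<lambda>t. 1 / ?p t" and g' = "\<lambda>t. - ?q t / (?p t)\<^sup>2"])
    fix t :: real assume t: "0 \<le> t" "t \<le> 1"
    show "DERIV (\<lambda>t. 1 / ?p t) t :> - ?q t / (?p t)\<^sup>2"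
      using DERIV_along_line(2)[OF diff in_S[OF t]] p_pos[OF t]
      by (auto intro!: derivative_eq_intros simp: power2_eq_square)
    show "- ?q t / (?p t)\<^sup>2 \<le> - (1 / \<nu>)"
      using pq[OF t] p_pos[OF t] \<open>0 < \<nu>\<close> by (simp add: field_simps)
  qed simp
  then have "1 / \<nu> \<le> 1 / ?p 0" using p_pos[of 1] by (smt (verit) divide_pos_pos)
  then show ?thesis using \<open>0 < \<nu>\<close> p0 by (simp add: h_def field_simps)
qed

text \<open>
At \<open>x - t h\<close> the domain is left at distance \<open>\<beta> + t\<close>, so the second derivative there is at least
\<open>1 / (\<beta> + t)\<^sup>2\<close>. Integrating over \<open>t\<close> gives \<open>1 / \<beta>\<close>, up to the derivative of \<open>f\<close> far out in the
recession direction \<open>- h\<close>, which is nonpositive in that direction because the barrier inequality bounds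
\<open>D1 f x (y - x)\<close> uniformly in \<open>y\<close>.
\<close>

lemma barrier_D1_ge_if_exit:
  assumes bar: "self_concordant_barrier S f \<nu>" and "x \<in> S"
    and rec: "\<And>t. 0 \<le> t \<Longrightarrow> x - t *\<^sub>R h \<in> S"
    and "0 < \<beta>" "x + \<beta> *\<^sub>R h \<notin> S"
  shows "1 / \<beta> \<le> D1 f x h"
proof (rule ccontr)
  assume "\<not> 1 / \<beta> \<le> D1 f x h"
  define g where "g = 1 / \<beta> - D1 f x h"
  have "0 < g" using \<open>\<not> 1 / \<beta> \<le> D1 f x h\<close> by (simp add: g_def)
  \<comment> \<open>far enough out that the missing part \<open>1 / (\<beta> + T)\<close> of the integral is less than the gap \<open>g\<close>\<close>
  define T where "T = 1 / g"
  have "0 < T" using \<open>0 < g\<close> by (simp add: T_def)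
  have sc: "self_concordant S f" using bar by (simp add: self_concordant_barrier_def)
  then have diff: "three_times_differentiable_on S f" by (auto simp: self_concordant_def)
  let ?p = "\<lambda>t. D1 f (x + t *\<^sub>R (- h)) (- h)"
  let ?q = "\<lambda>t. D2 f (x + t *\<^sub>R (- h)) (- h)"
  have in_S: "x + t *\<^sub>R (- h) \<in> S" if "0 \<le> t" for t using rec[OF that] by simp
  \<comment> \<open>a positive slope in a recession direction would make the pairing with distant points exceed \<open>\<nu>\<close>\<close>
  have "?p T \<le> 0"
  proof (rule ccontr)
    assume "\<not> ?p T \<le> 0"
    then have pos: "0 < ?p T" by simp
    have le: "k * ?p T \<le> \<nu>" if "0 < k" for k
    proof -
      have eq: "(x + (T + k) *\<^sub>R (- h)) - (x + T *\<^sub>R (- h)) = k *\<^sub>R (- h)"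
        by (simp add: algebra_simps)
      show ?thesis
        using barrier_D1_le[OF bar in_S[of T] in_S[of "T + k"]] \<open>0 < T\<close> that pos
        unfolding eq D1_scaleR by (simp add: mult_pos_pos)
    qed
    have "\<bar>\<nu>\<bar> + 1 = ((\<bar>\<nu>\<bar> + 1) / ?p T) * ?p T" using pos by simp
    also have "\<dots> \<le> \<nu>" using pos by (intro le) (auto intro: divide_pos_pos)
    finally show False by simp
  qed
  moreover have "- ?p T - 1 / (\<beta> + T) \<le> (- ?p 0 - 1 / (\<beta> + 0)) + 0 * T"
  proof (rule DERIV_bound_imp_growth[where g = "\<lambda>t. - ?p t - 1 / (\<beta> + t)"
        and g' = "\<lambda>t. - ?q t + 1 / (\<beta> + t)\<^sup>2"])
    fix t assume t: "0 \<le> t" "t \<le> T"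
    show "DERIV (\<lambda>t. - ?p t - 1 / (\<beta> + t)) t :> - ?q t + 1 / (\<beta> + t)\<^sup>2"
      using DERIV_along_line(2)[OF diff in_S[OF t(1)]] t \<open>0 < \<beta>\<close>
      by (auto intro!: derivative_eq_intros simp: power2_eq_square)
    have "x + t *\<^sub>R (- h) + (\<beta> + t) *\<^sub>R h \<notin> S"
      using assms by (simp add: algebra_simps)
    then show "- ?q t + 1 / (\<beta> + t)\<^sup>2 \<le> 0"
      using self_concordant_D2_ge_if_exit[OF sc in_S[OF t(1)], of "\<beta> + t" h] t \<open>0 < \<beta>\<close>
      by (simp add: D2_uminus)
  qed (use \<open>0 < T\<close> in simp)
  moreover have "?p 0 = - D1 f x h" using D1_scaleR[of f x "-1" h] by simp
  ultimately have "g \<le> 1 / (\<beta> + T)" by (simp add: g_def)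
  also have "\<dots> < 1 / T" using \<open>0 < \<beta>\<close> \<open>0 < T\<close> by (intro divide_strict_left_mono) auto
  also have "\<dots> = g" by (simp add: T_def)
  finally show False by simp
qed

text \<open>
Pair the gradient at \<open>x\<close> with \<open>\<Sum>i. \<alpha> i *\<^sub>R p i\<close>: each summand is at least \<open>\<alpha> i / \<beta> i\<close>, and
the whole is at most \<open>\<nu>\<close> since the displaced point is in the domain.
\<close>

theorem barrier_parameter_lower_bound:
  assumes bar: "self_concordant_barrier S f \<nu>" and "x \<in> S"
    and rec: "\<And>i t. i \<in> I \<Longrightarrow> 0 \<le> t \<Longrightarrow> x - t *\<^sub>R p i \<in> S"
    and exits: "\<And>i. i \<in> I \<Longrightarrow> 0 < \<beta> i" "\<And>i. i \<in> I \<Longrightarrow> x + \<beta> i *\<^sub>R p i \<notin> S"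
    and \<alpha>: "\<And>i. i \<in> I \<Longrightarrow> 0 \<le> \<alpha> i" and sum_in: "x + (\<Sum>i\<in>I. \<alpha> i *\<^sub>R p i) \<in> S"
    and pos: "0 < (\<Sum>i\<in>I. \<alpha> i / \<beta> i)"
  shows "(\<Sum>i\<in>I. \<alpha> i / \<beta> i) \<le> \<nu>"
proof -
  let ?y = "x + (\<Sum>i\<in>I. \<alpha> i *\<^sub>R p i)"
  have "(\<Sum>i\<in>I. \<alpha> i / \<beta> i) = (\<Sum>i\<in>I. \<alpha> i * (1 / \<beta> i))" by simp
  also have "\<dots> \<le> (\<Sum>i\<in>I. \<alpha> i * D1 f x (p i))"
    using barrier_D1_ge_if_exit[OF bar \<open>x \<in> S\<close> rec exits] \<alpha> by (intro sum_mono mult_left_mono) auto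
  also have "\<dots> = D1 f x (?y - x)" by (simp add: D1_sum D1_scaleR)
  finally have le: "(\<Sum>i\<in>I. \<alpha> i / \<beta> i) \<le> D1 f x (?y - x)" .
  also have "\<dots> \<le> \<nu>"
    using barrier_D1_le[OF bar \<open>x \<in> S\<close> sum_in] pos le by linarith
  finally show ?thesis .
qed

section \<open>Derivatives of the determinant and the inverse\<close>

lemma matrix_inv_inverse:
  fixes M :: "'a::semiring_1^'n^'m"
  assumes "invertible M"
  shows "M ** matrix_inv M = mat 1" "matrix_inv M ** M = mat 1"
  using someI_ex[OF assms[unfolded invertible_def]] by (auto simp: matrix_inv_def)

lemma matrix_inv_unique:
  fixes M :: "real^'n^'n"
  assumes "M ** W = mat 1"
  shows "matrix_inv M = W"
proof -
  have "invertible M" using assms invertible_right_inverse by blast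
  then have "matrix_inv M = matrix_inv M ** (M ** W)" using assms by simp
  also have "\<dots> = W" using matrix_inv_inverse(2)[OF \<open>invertible M\<close>] by (simp add: matrix_mul_assoc)
  finally show ?thesis .
qed

lemma inner_matrix_vector_transpose:
  fixes A :: "real^'n^'m"
  shows "x \<bullet> (A *v z) = (transpose A *v x) \<bullet> z"
  by (simp add: dot_lmul_matrix)

lemma bounded_bilinear_matrix_matrix_mult:
  "bounded_bilinear ((**) :: real^'n^'m \<Rightarrow> real^'p^'n \<Rightarrow> real^'p^'m)"
  unfolding bilinear_conv_bounded_bilinear[symmetric] bilinear_def
  by (auto intro!: linearI simp: vec_eq_iff matrix_matrix_mult_def sum.distrib
      distrib_left distrib_right sum_distrib_left mult_ac)

text \<open>
The determinant is affine in row \<open>i\<close>, and Cramer's rule identifies the slope, a cofactor.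
\<close>

lemma det_row_update:
  fixes M :: "real^'n^'n"
  assumes "invertible M"
  shows "det (M + t *\<^sub>R axis i (axis j 1)) = det M + t * (det M * matrix_inv M $ j $ i)"
proof -
  let ?W = "matrix_inv M"
  have "row j (?W ** M) = (\<Sum>k\<in>UNIV. row j ?W $ k *s row k M)"
    by (simp add: vec_eq_iff row_def matrix_matrix_mult_def)
  moreover have "row j (?W ** M) = axis j 1"
    using matrix_inv_inverse(2)[OF assms] by (simp add: vec_eq_iff row_def mat_def axis_def)
  ultimately have cramer: "det (\<chi> k. if k = i then axis j 1 else row k M) = ?W $ j $ i * det M"
    using cramer_lemma_transpose[of i "row j ?W" M] by (simp add: row_def[of j ?W] cong: if_cong)
  have "M + t *\<^sub>R axis i (axis j 1) = (\<chi> k. if k = i then row k M + t *s axis j 1 else row k M)"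
    by (auto simp: vec_eq_iff row_def axis_def)
  moreover have "(\<chi> k. if k = i then row k M else row k M) = M"
    by (simp add: vec_eq_iff row_def)
  ultimately show ?thesis
    using det_row_add[of i "\<lambda>k. row k M" "\<lambda>k. t *s axis j 1" "\<lambda>k. row k M"]
      det_row_mul[of i t "\<lambda>k. axis j 1" "\<lambda>k. row k M"] cramer
    by simp
qed

lemma differentiable_det:
  "(det :: real^'n^'n \<Rightarrow> real) differentiable at M"
proof -
  have nth: "(\<lambda>M :: real^'n^'n. M $ i $ j) differentiable at M" for i j
    by (intro bounded_linear_imp_differentiable bounded_linear_compose[OF bounded_linear_vec_nth]
        bounded_linear_vec_nth)
  have prod: "(\<lambda>M :: real^'n^'n. \<Prod>i\<in>I. M $ i $ p i) differentiable at M" if "finite I" for I p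
    using that by (induction I rule: finite_induct) (auto intro!: differentiable_mult nth)
  show ?thesis unfolding det_def
    by (intro differentiable_sum differentiable_mult differentiable_const prod ballI)
      (auto simp: finite_permutations)
qed

lemma matrix_eq_sum_axis:
  fixes N :: "real^'n^'m"
  shows "N = (\<Sum>i\<in>UNIV. \<Sum>j\<in>UNIV. N $ i $ j *\<^sub>R axis i (axis j 1))"
proof -
  have "(\<Sum>i\<in>UNIV. \<Sum>j\<in>UNIV. N $ i $ j *\<^sub>R axis i (axis j 1) :: real^'n^'m) $ k $ l = N $ k $ l" for k l
  proof -
    have "(\<Sum>i\<in>UNIV. \<Sum>j\<in>UNIV. N $ i $ j *\<^sub>R axis i (axis j 1) :: real^'n^'m) $ k $ l
        = (\<Sum>i\<in>UNIV. if i = k then \<Sum>j\<in>UNIV. if j = l then N $ i $ j else 0 else 0)"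
      unfolding sum_component by (intro sum.cong) (auto simp: axis_def simp del: sum.delta sum.delta' intro!: sum.cong)
    also have "\<dots> = N $ k $ l" by simp
    finally show ?thesis .
  qed
  then show ?thesis by (simp add: vec_eq_iff[of N] vec_eq_iff[of "N $ _"])
qed

text \<open>
Jacobi's formula. The determinant is a polynomial, hence differentiable, so its derivative is
determined by the entrywise directions.
\<close>

lemma has_derivative_det:
  fixes M :: "real^'n^'n"
  assumes "invertible M"
  shows "(det has_derivative (\<lambda>N. det M * trace (matrix_inv M ** N))) (at M)"
proof -
  obtain L where L: "(det has_derivative L) (at M)"
    using differentiable_det by (auto simp: differentiable_def)
  have "linear L" using L has_derivative_linear by blast
  have partial: "L (axis i (axis j 1)) = det M * matrix_inv M $ j $ i" for i j
  proof -
    let ?E = "axis i (axis j 1) :: real^'n^'n"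
    have "((\<lambda>t. M + t *\<^sub>R ?E) has_derivative (\<lambda>t. t *\<^sub>R ?E)) (at 0)"
      by (auto intro!: derivative_eq_intros)
    moreover have "(det has_derivative L) (at (M + 0 *\<^sub>R ?E))" using L by simp
    ultimately have "((\<lambda>t. det (M + t *\<^sub>R ?E)) has_derivative (\<lambda>t. L (t *\<^sub>R ?E))) (at 0)"
      using diff_chain_at by (fastforce simp: o_def)
    moreover have "((\<lambda>t. det (M + t *\<^sub>R ?E)) has_derivative (\<lambda>t. t * (det M * matrix_inv M $ j $ i))) (at 0)"
      unfolding det_row_update[OF assms] by (auto intro!: derivative_eq_intros)
    ultimately have "(\<lambda>t. L (t *\<^sub>R ?E)) = (\<lambda>t. t * (det M * matrix_inv M $ j $ i))"
      by (rule has_derivative_unique)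
    from fun_cong[OF this, of 1] show ?thesis by simp
  qed
  have "L N = det M * trace (matrix_inv M ** N)" for N
  proof -
    have "L N = (\<Sum>i\<in>UNIV. \<Sum>j\<in>UNIV. N $ i $ j * (det M * matrix_inv M $ j $ i))"
      by (subst matrix_eq_sum_axis)
        (simp add: linear_sum[OF \<open>linear L\<close>] linear_cmul[OF \<open>linear L\<close>] partial)
    also have "\<dots> = det M * trace (matrix_inv M ** N)"
      unfolding trace_def matrix_matrix_mult_def
      by (subst sum.swap) (simp add: sum_distrib_left mult_ac)
    finally show ?thesis .
  qed
  then have "L = (\<lambda>N. det M * trace (matrix_inv M ** N))" by blast
  then show ?thesis using L by simp
qed

lemma continuous_on_det: "continuous_on S (det :: real^'n^'n \<Rightarrow> real)"
  using differentiable_det differentiable_imp_continuous_within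
  by (metis continuous_at_imp_continuous_on)

lemma open_invertible: "open {M :: real^'n^'n. invertible M}"
proof -
  have "{M :: real^'n^'n. invertible M} = det -` (- {0})" by (auto simp: invertible_det_nz)
  then show ?thesis using open_vimage[OF _ continuous_on_det, of "- {0}"] by auto
qed

lemma matrix_inv_cramer:
  fixes M :: "real^'n^'n"
  assumes "invertible M"
  shows "matrix_inv M $ k $ j = det (\<chi> a b. if b = k then axis j 1 $ a else M $ a $ b) / det M"
proof -
  let ?x = "column j (matrix_inv M)"
  have "M *v ?x = axis j 1"
    using matrix_inv_inverse(1)[OF assms]
    by (simp flip: matrix_vector_mult_basis add: matrix_vector_mul_assoc)
  then have "det (\<chi> a b. if b = k then axis j 1 $ a else M $ a $ b) = ?x $ k * det M"
    using cramer_lemma[of k M ?x] by (simp only:)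
  then show ?thesis using assms by (simp add: column_def invertible_det_nz)
qed

text \<open>
Cramer's rule makes the entries of the inverse quotients of polynomials, hence differentiable;
the derivative then follows by differentiating \<open>M ** matrix_inv M = mat 1\<close>.
\<close>

lemma has_derivative_matrix_inv:
  fixes M :: "real^'n^'n"
  assumes "invertible M"
  shows "(matrix_inv has_derivative (\<lambda>N. - (matrix_inv M ** N ** matrix_inv M))) (at M)"
proof -
  interpret mult: bounded_bilinear "(**) :: real^'n^'n \<Rightarrow> real^'n^'n \<Rightarrow> real^'n^'n"
    by (rule bounded_bilinear_matrix_matrix_mult)
  have nth: "(\<lambda>M :: real^'n^'n. M $ i $ j) differentiable at M" for i j
    by (intro bounded_linear_imp_differentiable bounded_linear_compose[OF bounded_linear_vec_nth]
        bounded_linear_vec_nth)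
  have entry: "(\<lambda>M :: real^'n^'n. matrix_inv M $ k $ j) differentiable at M" for k j
  proof -
    let ?r = "\<lambda>M :: real^'n^'n. (\<chi> a b. if b = k then axis j 1 $ a else M $ a $ b) :: real^'n^'n"
    have upd: "(\<lambda>M :: real^'n^'n. if b = k then axis j 1 $ a else M $ a $ b) differentiable at M" for a b
      using nth by (cases "b = k") auto
    have "?r differentiable at M"
      by (subst differentiable_componentwise_within)
        (auto simp: Basis_vec_def inner_axis upd)
    then have "(\<lambda>M. det (?r M)) differentiable at M"
      using differentiable_compose[of det ?r M UNIV] differentiable_det by auto
    then have "(\<lambda>M. det (?r M) / det M) differentiable at M"
      using differentiable_det assms by (intro differentiable_divide) (auto simp: invertible_det_nz)
    then obtain L where "((\<lambda>M. det (?r M) / det M) has_derivative L) (at M)"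
      by (auto simp: differentiable_def)
    then have "((\<lambda>M :: real^'n^'n. matrix_inv M $ k $ j) has_derivative L) (at M)"
      by (rule has_derivative_transform_within_open[OF _ open_invertible])
        (use assms in \<open>simp_all only: mem_Collect_eq matrix_inv_cramer\<close>)
    then show ?thesis by (auto simp: differentiable_def)
  qed
  have "(matrix_inv :: real^'n^'n \<Rightarrow> _) differentiable at M"
    by (subst differentiable_componentwise_within) (auto simp: Basis_vec_def inner_axis entry)
  then obtain L where L: "(matrix_inv has_derivative L) (at M)" by (auto simp: differentiable_def)
  have "((\<lambda>M. M ** matrix_inv M) has_derivative (\<lambda>N. M ** L N + N ** matrix_inv M)) (at M)"
    by (rule mult.FDERIV[OF has_derivative_ident L])
  moreover have "((\<lambda>M. M ** matrix_inv M) has_derivative (\<lambda>N. 0)) (at M)"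
    by (rule has_derivative_transform_within_open[OF _ open_invertible, where f = "\<lambda>_. mat 1"])
      (use assms in \<open>auto simp: matrix_inv_inverse(1)\<close>)
  ultimately have "(\<lambda>N. M ** L N + N ** matrix_inv M) = (\<lambda>N. 0)" by (rule has_derivative_unique)
  then have eq: "M ** L N = - (N ** matrix_inv M)" for N by (metis eq_neg_iff_add_eq_0)
  have "L N = - (matrix_inv M ** N ** matrix_inv M)" for N
  proof -
    have "L N = matrix_inv M ** (M ** L N)"
      by (simp add: matrix_mul_assoc matrix_inv_inverse[OF assms])
    then show ?thesis by (simp add: eq mult.minus_right matrix_mul_assoc)
  qed
  then have "L = (\<lambda>N. - (matrix_inv M ** N ** matrix_inv M))" by blast
  then show ?thesis using L by simp
qed

section \<open>Positive semidefinite matrices\<close>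

definition pos_semidef :: "real^'n^'n \<Rightarrow> bool" where
  "pos_semidef M \<longleftrightarrow> transpose M = M \<and> (\<forall>x. 0 \<le> x \<bullet> (M *v x))"

lemma pos_def_imp_pos_semidef: "pos_def M \<Longrightarrow> pos_semidef M"
  unfolding pos_def_def pos_semidef_def
  by (metis inner_zero_left less_imp_le order_refl)

lemma symmetric_nth:
  assumes "transpose M = M"
  shows "M $ i $ j = M $ j $ i"
  using arg_cong[OF assms, of "\<lambda>A. A $ j $ i"] by (simp add: transpose_def)

lemma quadratic_form_add_axis:
  fixes M :: "real^'n^'n"
  assumes "transpose M = M"
  shows "(x + t *\<^sub>R axis i 1) \<bullet> (M *v (x + t *\<^sub>R axis i 1))
    = x \<bullet> (M *v x) + 2 * t * (M *v x) $ i + t\<^sup>2 * M $ i $ i"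
proof -
  define e :: "real^'n" where "e = axis i 1"
  have "x \<bullet> (M *v e) = (M *v x) $ i"
    using inner_matrix_vector_transpose[of x M e] assms by (simp add: e_def inner_axis)
  moreover have "e \<bullet> (M *v e) = M $ i $ i"
    by (simp add: e_def matrix_vector_mult_basis column_def inner_axis')
  moreover have "e \<bullet> (M *v x) = (M *v x) $ i" by (simp add: e_def inner_axis')
  moreover have "(x + t *\<^sub>R e) \<bullet> (M *v (x + t *\<^sub>R e))
    = x \<bullet> (M *v x) + t * (x \<bullet> (M *v e)) + t * (e \<bullet> (M *v x)) + t * (t * (e \<bullet> (M *v e)))"
    by (simp add: matrix_vector_right_distrib matrix_vector_mult_scaleR inner_add_left
        inner_add_right distrib_left)
  ultimately show ?thesis unfolding e_def[symmetric] by (simp only:) (simp add: power2_eq_square)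
qed

text \<open>
Otherwise the quadratic form, which is affine in \<open>t\<close> along \<open>axis k 1 + t *\<^sub>R axis i 1\<close>, would take
a negative value.
\<close>

lemma pos_semidef_zero_diag:
  assumes "pos_semidef M" "M $ i $ i = 0"
  shows "M $ i $ k = 0"
proof -
  have sym: "transpose M = M" using assms by (simp add: pos_semidef_def)
  have ik: "(M *v axis k 1) $ i = M $ i $ k" by (simp add: matrix_vector_mult_basis column_def)
  have nonneg: "0 \<le> M $ k $ k + 2 * t * M $ i $ k" for t
  proof -
    have "0 \<le> (axis k 1 + t *\<^sub>R axis i 1) \<bullet> (M *v (axis k 1 + t *\<^sub>R axis i 1))"
      using assms(1) unfolding pos_semidef_def by blast
    then show ?thesis
      unfolding quadratic_form_add_axis[OF sym] ik
      by (simp add: assms(2) matrix_vector_mult_basis inner_axis' column_def)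
  qed
  show ?thesis
  proof (rule ccontr)
    assume ne: "M $ i $ k \<noteq> 0"
    \<comment> \<open>chosen so that the form takes the value \<open>-1\<close>\<close>
    define t where "t = - (M $ k $ k + 1) / (2 * M $ i $ k)"
    have "2 * t * M $ i $ k = - (M $ k $ k + 1)" unfolding t_def using ne by simp
    then show False using nonneg[of t] by linarith
  qed
qed

text \<open>
One step of Lagrange's reduction: the new form at \<open>x\<close> is the minimum of the old one on the line
through \<open>x\<close> in direction \<open>axis i 1\<close>.
\<close>

lemma pos_semidef_eliminate:
  assumes "pos_semidef M" "M $ i $ i \<noteq> 0"
  shows "0 < M $ i $ i" "pos_semidef (\<chi> j k. M $ j $ k - M $ i $ j * M $ i $ k / M $ i $ i)"
proof -
  have sym: "transpose M = M" using assms by (simp add: pos_semidef_def)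
  have "0 \<le> (axis i 1 :: real^_) \<bullet> (M *v axis i 1)" using assms by (simp add: pos_semidef_def)
  then show pos: "0 < M $ i $ i"
    using assms(2) by (simp add: matrix_vector_mult_basis inner_axis' column_def)
  let ?M' = "\<chi> j k. M $ j $ k - M $ i $ j * M $ i $ k / M $ i $ i"
  have "transpose ?M' = ?M'"
    using sym by (simp add: transpose_def vec_eq_iff mult.commute)
  moreover have "0 \<le> x \<bullet> (?M' *v x)" for x
  proof -
    let ?m = "(M *v x) $ i"
    have "?M' *v x = M *v x - (?m / M $ i $ i) *\<^sub>R M $ i"
      by (simp add: vec_eq_iff matrix_vector_mult_def sum_subtractf left_diff_distrib right_diff_distrib
          sum_distrib_left sum_distrib_right sum_divide_distrib mult_ac)
    moreover have "x \<bullet> M $ i = ?m" by (simp add: matrix_mult_dot inner_commute)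
    ultimately have "x \<bullet> (?M' *v x) = x \<bullet> (M *v x) - ?m\<^sup>2 / M $ i $ i"
      by (simp add: inner_diff_right power2_eq_square)
    also have "\<dots> = x \<bullet> (M *v x) + 2 * (- ?m / M $ i $ i) * ?m + (- ?m / M $ i $ i)\<^sup>2 * M $ i $ i"
      using pos by (simp add: field_simps power2_eq_square)
    also have "\<dots> = (x + (- ?m / M $ i $ i) *\<^sub>R axis i 1) \<bullet> (M *v (x + (- ?m / M $ i $ i) *\<^sub>R axis i 1))"
      by (rule quadratic_form_add_axis[OF sym, symmetric])
    also have "0 \<le> \<dots>" using assms by (auto simp: pos_semidef_def)
    finally show ?thesis .
  qed
  ultimately show "pos_semidef ?M'" by (simp add: pos_semidef_def)
qed

text \<open>
Eliminating one index after another writes \<open>M\<close> as a sum of at most one square of a linear form for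
each index; row \<open>a\<close> of \<open>R\<close> is the form split off at index \<open>a\<close>. That \<open>R\<close> is square matters: its
size becomes the barrier parameter.
\<close>

lemma pos_semidef_factor:
  fixes M :: "real^'n^'n"
  assumes "pos_semidef M"
  obtains R :: "real^'n^'n" where "M = transpose R ** R"
proof -
  have "\<exists>R :: real^'n^'n. (\<forall>a. a \<notin> J \<longrightarrow> R $ a = 0) \<and> M = transpose R ** R"
    if "finite J" "pos_semidef M" "\<forall>i j. i \<notin> J \<longrightarrow> M $ i $ j = 0" for J :: "'n set" and M :: "real^'n^'n"
    using that
  proof (induction J arbitrary: M rule: finite_induct)
    case empty
    then have "M = transpose 0 ** 0" by (simp add: vec_eq_iff matrix_matrix_mult_def)
    then show ?case by (intro exI[of _ 0]) simp
  next
    case (insert i J)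
    have sym_M: "M $ j $ k = M $ k $ j" for j k
      using insert.prems(1)[unfolded pos_semidef_def, THEN conjunct1] by (rule symmetric_nth)
    show ?case
    proof (cases "M $ i $ i = 0")
      case True
      have "M $ k $ j = 0" if "k \<notin> J" for k j
        using that insert.prems(2) pos_semidef_zero_diag[OF insert.prems(1) True]
        by (cases "k = i") auto
      then obtain R :: "real^'n^'n" where "\<forall>a. a \<notin> J \<longrightarrow> R $ a = 0" "M = transpose R ** R"
        using insert.IH[OF insert.prems(1)] by blast
      then show ?thesis by blast
    next
      case False
      let ?M' = "\<chi> j k. M $ j $ k - M $ i $ j * M $ i $ k / M $ i $ i"
      note elim = pos_semidef_eliminate[OF insert.prems(1) False]
      have "?M' $ k $ j = 0" if "k \<notin> J" for k j
        using that insert.prems(2) False sym_M[of i k] by (cases "k = i") auto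
      then have "\<forall>k j. k \<notin> J \<longrightarrow> ?M' $ k $ j = 0" by blast
      from insert.IH[OF elim(2) this] obtain R :: "real^'n^'n"
        where R0: "\<forall>a. a \<notin> J \<longrightarrow> R $ a = 0" and R: "?M' = transpose R ** R" by blast
      let ?R = "\<chi> a. if a = i then (1 / sqrt (M $ i $ i)) *\<^sub>R M $ i else R $ a"
      have "(transpose ?R ** ?R) $ j $ k = M $ j $ k" for j k
      proof -
        have "(transpose ?R ** ?R) $ j $ k = (\<Sum>a\<in>UNIV. ?R $ a $ j * ?R $ a $ k)"
          by (simp add: matrix_matrix_mult_def transpose_def)
        also have "\<dots> = ?R $ i $ j * ?R $ i $ k + (\<Sum>a\<in>UNIV-{i}. R $ a $ j * R $ a $ k)"
          by (subst sum.remove[of _ i]) auto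
        also have "(\<Sum>a\<in>UNIV-{i}. R $ a $ j * R $ a $ k) = (\<Sum>a\<in>UNIV. R $ a $ j * R $ a $ k)"
          using R0 insert.hyps by (intro sum.mono_neutral_left) auto
        also have "\<dots> = ?M' $ j $ k"
          unfolding R by (simp add: matrix_matrix_mult_def transpose_def)
        also have "?R $ i $ j * ?R $ i $ k = M $ i $ j * M $ i $ k / M $ i $ i"
          using elim(1) by simp
        finally show ?thesis by simp
      qed
      then have "M = transpose ?R ** ?R" by (simp add: vec_eq_iff)
      moreover have "\<forall>a. a \<notin> insert i J \<longrightarrow> ?R $ a = 0" using R0 by auto
      ultimately show ?thesis by blast
    qed
  qed
  from this[of UNIV M] assms show ?thesis using that by auto
qed

lemma pos_semidef_invertible_det_pos:
  fixes M :: "real^'n^'n"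
  assumes "pos_semidef M" "invertible M"
  shows "0 < det M"
proof -
  obtain R :: "real^'n^'n" where "M = transpose R ** R" by (rule pos_semidef_factor[OF assms(1)])
  then have "det M = (det R)\<^sup>2" by (simp add: det_mul power2_eq_square)
  then show ?thesis using assms(2) by (auto simp: invertible_det_nz)
qed

lemma pos_semidef_invertible_imp_pos_def:
  fixes M :: "real^'n^'n"
  assumes "pos_semidef M" "invertible M"
  shows "pos_def M"
  unfolding pos_def_def
proof (intro conjI allI impI)
  obtain R :: "real^'n^'n" where R: "M = transpose R ** R" by (rule pos_semidef_factor[OF assms(1)])
  fix x :: "real^'n" assume "x \<noteq> 0"
  have "M *v x \<noteq> 0"
    using \<open>x \<noteq> 0\<close> inj_matrix_vector_mult[OF assms(2)] by (metis injD matrix_vector_mult_0_right)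
  then have "R *v x \<noteq> 0" by (auto simp: R simp flip: matrix_vector_mul_assoc)
  moreover have "x \<bullet> (M *v x) = (R *v x) \<bullet> (R *v x)"
    unfolding R using inner_matrix_vector_transpose[of x "transpose R" "R *v x"]
    by (simp add: transpose_transpose flip: matrix_vector_mul_assoc)
  ultimately show "0 < x \<bullet> (M *v x)" by simp
qed (use assms in \<open>simp add: pos_semidef_def\<close>)

lemma pos_def_invertible:
  assumes "pos_def M"
  shows "invertible M"
proof -
  have "x = 0" if "M *v x = 0" for x
    using assms that unfolding pos_def_def by (metis inner_zero_right less_irrefl)
  then show ?thesis
    using invertible_left_inverse matrix_left_invertible_ker by blast
qed

lemma pos_def_det_pos: "pos_def M \<Longrightarrow> 0 < det M"
  by (simp add: pos_def_imp_pos_semidef pos_def_invertible pos_semidef_invertible_det_pos)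

lemma transpose_matrix_inv:
  fixes M :: "real^'n^'n"
  assumes "invertible M" "transpose M = M"
  shows "transpose (matrix_inv M) = matrix_inv M"
proof (rule matrix_inv_unique[symmetric])
  have "M ** transpose (matrix_inv M) = transpose (matrix_inv M ** M)"
    using assms(2) by (simp add: matrix_transpose_mul)
  then show "M ** transpose (matrix_inv M) = mat 1"
    using matrix_inv_inverse[OF assms(1)] by simp
qed

lemma pos_def_matrix_inv:
  assumes "pos_def M"
  shows "pos_def (matrix_inv M)"
  unfolding pos_def_def
proof (intro conjI allI impI)
  note inv = pos_def_invertible[OF assms]
  show "transpose (matrix_inv M) = matrix_inv M"
    using transpose_matrix_inv[OF inv] assms by (simp add: pos_def_def)
  fix x :: "real^'a" assume "x \<noteq> 0"
  let ?z = "matrix_inv M *v x"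
  have x: "M *v ?z = x" by (simp add: matrix_vector_mul_assoc matrix_inv_inverse[OF inv])
  then have "?z \<noteq> 0" using \<open>x \<noteq> 0\<close> by auto
  then have "0 < ?z \<bullet> (M *v ?z)" using assms unfolding pos_def_def by blast
  then show "0 < x \<bullet> ?z" by (simp add: x inner_commute)
qed

lemma pos_semidef_congruence:
  assumes "pos_semidef W"
  shows "pos_semidef (A ** W ** transpose A)"
  unfolding pos_semidef_def
proof (intro conjI allI)
  show "transpose (A ** W ** transpose A) = A ** W ** transpose A"
    using assms by (simp add: pos_semidef_def matrix_transpose_mul transpose_transpose matrix_mul_assoc)
  fix x
  have "x \<bullet> ((A ** W ** transpose A) *v x) = (transpose A *v x) \<bullet> (W *v (transpose A *v x))"
    using inner_matrix_vector_transpose[of x A "W *v (transpose A *v x)"]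
    by (simp flip: matrix_vector_mul_assoc)
  then show "0 \<le> x \<bullet> ((A ** W ** transpose A) *v x)"
    using assms by (simp add: pos_semidef_def)
qed

section \<open>Barriers whose gradient is the diagonal of a matrix field\<close>

text \<open>
The coordinate functionals as bounded linear maps, from which the values of \<open>fderiv\<close> are built.
\<close>

definition coord :: "'m::finite \<Rightarrow> (real^'m) \<Rightarrow>\<^sub>L real" where
  "coord j = blinfun_inner_left (axis j 1)"

lemma coord_apply [simp]: "blinfun_apply (coord j) h = h $ j"
  by (simp add: coord_def inner_axis)

text \<open>
A function that is a combination of fixed vectors with scalar coefficient functions has a
derivative of the same shape, one level higher in the tower of bounded linear maps. Iterating
this reduces Frechet derivatives of any order to derivatives of scalar coefficients.
\<close>

lemma fderiv_sum_scaleR: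
  fixes F :: "real^'m \<Rightarrow> 'b::real_normed_vector"
  assumes "open S" "x \<in> S" and F: "\<And>y. y \<in> S \<Longrightarrow> F y = (\<Sum>k\<in>I. c k y *\<^sub>R B k)"
    and c: "\<And>k. k \<in> I \<Longrightarrow> (c k has_derivative (\<lambda>h. \<Sum>j\<in>UNIV. d k j * h $ j)) (at x)"
  shows "F differentiable at x"
    and "fderiv F x = (\<Sum>(k, j)\<in>I \<times> UNIV. d k j *\<^sub>R (blinfun_scaleR_left (B k) o\<^sub>L coord j))"
proof -
  have "((\<lambda>y. \<Sum>k\<in>I. c k y *\<^sub>R B k) has_derivative
      (\<lambda>h. \<Sum>k\<in>I. (\<Sum>j\<in>UNIV. d k j * h $ j) *\<^sub>R B k)) (at x)"
    by (intro has_derivative_sum has_derivative_scaleR_left c)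
  then have der: "(F has_derivative (\<lambda>h. \<Sum>k\<in>I. (\<Sum>j\<in>UNIV. d k j * h $ j) *\<^sub>R B k)) (at x)"
    by (rule has_derivative_transform_within_open[OF _ \<open>open S\<close> \<open>x \<in> S\<close>]) (simp add: F)
  then show "F differentiable at x" by (auto simp: differentiable_def)
  show "fderiv F x = (\<Sum>(k, j)\<in>I \<times> UNIV. d k j *\<^sub>R (blinfun_scaleR_left (B k) o\<^sub>L coord j))"
    by (rule blinfun_eqI)
      (simp add: blinfun_apply_fderiv_eq[OF der] blinfun.sum_left blinfun.scaleR_left
        scaleR_sum_left sum.cartesian_product split_def)
qed

context
  fixes S :: "(real^'m) set" and f :: "real^'m \<Rightarrow> real" and V :: "real^'m \<Rightarrow> real^'m^'m"
  assumes S: "open S"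
    and f: "\<And>y. y \<in> S \<Longrightarrow> (f has_derivative (\<lambda>h. \<Sum>j\<in>UNIV. V y $ j $ j * h $ j)) (at y)"
    and V: "\<And>y i j. y \<in> S \<Longrightarrow> ((\<lambda>y. V y $ i $ j) has_derivative
          (\<lambda>h. \<Sum>k\<in>UNIV. V y $ i $ k * V y $ k $ j * h $ k)) (at y)"
begin

lemma three_derivatives_of_matrix_field:
  shows "three_times_differentiable_on S f"
    and "y \<in> S \<Longrightarrow> D1 f y h = (\<Sum>j\<in>UNIV. V y $ j $ j * h $ j)"
    and "y \<in> S \<Longrightarrow> D2 f y h = (\<Sum>j\<in>UNIV. \<Sum>i\<in>UNIV. V y $ j $ i * V y $ i $ j * h $ i * h $ j)"
    and "y \<in> S \<Longrightarrow> D3 f y h =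
      2 * (\<Sum>j\<in>UNIV. \<Sum>i\<in>UNIV. \<Sum>l\<in>UNIV. V y $ j $ i * V y $ i $ l * V y $ l $ j * h $ l * h $ i * h $ j)"
proof -
  \<comment> \<open>at level 1, 2, 3 the coefficients \<open>c\<close> belong to the fixed multilinear forms \<open>B\<close>\<close>
  define B1 where "B1 = (\<lambda>(k :: unit, j). blinfun_scaleR_left (1 :: real) o\<^sub>L coord j :: (real^'m) \<Rightarrow>\<^sub>L real)"
  define B2 where "B2 = (\<lambda>(k, j :: 'm). blinfun_scaleR_left (B1 k) o\<^sub>L coord j)"
  define B3 where "B3 = (\<lambda>(k, j :: 'm). blinfun_scaleR_left (B2 k) o\<^sub>L coord j)"
  define c1 where "c1 = (\<lambda>(k :: unit, j) y. V y $ j $ j)"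
  define c2 where "c2 = (\<lambda>((k :: unit, j), i) y. V y $ j $ i * V y $ i $ j)"
  define c3 where "c3 = (\<lambda>(((k :: unit, j), i), l) y. V y $ j $ l * V y $ l $ i * V y $ i $ j
      + V y $ j $ i * (V y $ i $ l * V y $ l $ j))"
  define I where "I = {()} \<times> (UNIV :: 'm set)"
  have der1: "(c1 k has_derivative (\<lambda>h. \<Sum>i\<in>UNIV. c2 (k, i) y * h $ i)) (at y)"
    if "y \<in> S" for y k
    using V[OF that] by (auto simp: c1_def c2_def split: prod.splits)
  have der2: "(c2 k has_derivative (\<lambda>h. \<Sum>l\<in>UNIV. c3 (k, l) y * h $ l)) (at y)"
    if "y \<in> S" for y k
  proof -
    obtain j i where k: "k = (((), j), i)" by (metis (full_types) old.unit.exhaust surj_pair)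
    show ?thesis
      unfolding k c2_def c3_def prod.case
      by (rule has_derivative_eq_rhs[OF has_derivative_mult[OF V[OF that] V[OF that]]])
        (simp add: fun_eq_iff sum.distrib sum_distrib_left sum_distrib_right algebra_simps)
  qed
  have F0: "f differentiable at y" "fderiv f y = (\<Sum>k\<in>I. c1 k y *\<^sub>R B1 k)" if "y \<in> S" for y
    using fderiv_sum_scaleR[OF S that, where F = f and I = "{()}" and c = "\<lambda>_. f" and B = "\<lambda>_. 1"
        and d = "\<lambda>_ j. V y $ j $ j"] f[OF that]
    by (simp_all add: c1_def B1_def I_def split_def)
  have F1: "fderiv f differentiable at y" "fderiv (fderiv f) y = (\<Sum>k\<in>I \<times> UNIV. c2 k y *\<^sub>R B2 k)"
    if "y \<in> S" for y
    using fderiv_sum_scaleR[OF S that, where F = "fderiv f" and I = I and c = c1 and B = B1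
        and d = "\<lambda>k j. c2 (k, j) y"] F0 der1[OF that]
    by (simp_all add: B2_def split_def)
  have F2: "fderiv (fderiv f) differentiable at y"
    "fderiv (fderiv (fderiv f)) y = (\<Sum>k\<in>(I \<times> UNIV) \<times> UNIV. c3 k y *\<^sub>R B3 k)"
    if "y \<in> S" for y
    using fderiv_sum_scaleR[OF S that, where F = "fderiv (fderiv f)" and I = "I \<times> UNIV" and c = c2 and B = B2
        and d = "\<lambda>k j. c3 (k, j) y"] F1 der2[OF that]
    by (simp_all add: B3_def split_def)
  show "three_times_differentiable_on S f"
    using F0 F1 F2 by (simp add: three_times_differentiable_on_def)
  have I_sum: "sum g I = (\<Sum>j\<in>UNIV. g ((), j))" for g :: "unit \<times> 'm \<Rightarrow> real"
    by (simp add: I_def flip: sum.cartesian_product[of "\<lambda>k j. g (k, j)", simplified split_def prod.collapse])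
  have sum_Times: "sum g (J \<times> UNIV) = (\<Sum>k\<in>J. \<Sum>i\<in>UNIV. g (k, i))"
    for g :: "'k \<times> 'm \<Rightarrow> real" and J
    using sum.cartesian_product[of "\<lambda>k j. g (k, j)" UNIV J] by simp
  show "D1 f y h = (\<Sum>j\<in>UNIV. V y $ j $ j * h $ j)" if "y \<in> S"
    unfolding D1_def F0(2)[OF that]
    by (simp add: blinfun.sum_left blinfun.scaleR_left I_sum c1_def B1_def)
  show "D2 f y h = (\<Sum>j\<in>UNIV. \<Sum>i\<in>UNIV. V y $ j $ i * V y $ i $ j * h $ i * h $ j)" if "y \<in> S"
    unfolding D2_def F1(2)[OF that]
    by (simp add: blinfun.sum_left blinfun.scaleR_left sum_Times I_sum c2_def B2_def B1_def mult.assoc)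
  show "D3 f y h =
      2 * (\<Sum>j\<in>UNIV. \<Sum>i\<in>UNIV. \<Sum>l\<in>UNIV. V y $ j $ i * V y $ i $ l * V y $ l $ j * h $ l * h $ i * h $ j)"
    if "y \<in> S"
  proof -
    let ?g = "\<lambda>j i l. V y $ j $ i * V y $ i $ l * V y $ l $ j * h $ l * h $ i * h $ j"
    have "D3 f y h = (\<Sum>j\<in>UNIV. \<Sum>i\<in>UNIV. \<Sum>l\<in>UNIV. ?g j l i + ?g j i l)"
      unfolding D3_def F2(2)[OF that]
      by (simp add: blinfun.sum_left blinfun.scaleR_left sum_Times I_sum c3_def B3_def B2_def B1_def
          distrib_left distrib_right mult_ac)
    also have "\<dots> = (\<Sum>j\<in>UNIV. (\<Sum>i\<in>UNIV. \<Sum>l\<in>UNIV. ?g j l i) + (\<Sum>i\<in>UNIV. \<Sum>l\<in>UNIV. ?g j i l))"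
      by (simp only: sum.distrib)
    \<comment> \<open>the two terms of the product rule differ by renaming the summation indices\<close>
    also have "\<dots> = (\<Sum>j\<in>UNIV. 2 * (\<Sum>i\<in>UNIV. \<Sum>l\<in>UNIV. ?g j i l))"
    proof (rule sum.cong[OF refl])
      fix j
      show "(\<Sum>i\<in>UNIV. \<Sum>l\<in>UNIV. ?g j l i) + (\<Sum>i\<in>UNIV. \<Sum>l\<in>UNIV. ?g j i l) =
          2 * (\<Sum>i\<in>UNIV. \<Sum>l\<in>UNIV. ?g j i l)"
        by (subst sum.swap) simp
    qed
    finally show ?thesis by (simp only: sum_distrib_left)
  qed
qed

end

lemma matrix_mult_Diag: "(M ** Diag h) $ i $ j = M $ i $ j * h $ j"
  by (simp add: matrix_matrix_mult_def Diag_def if_distrib cong: if_cong)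

lemma trace_mult_transpose: "trace (A ** transpose B) = A \<bullet> B"
  for A B :: "real^'n^'m"
  by (simp add: trace_def matrix_matrix_mult_def transpose_def inner_vec_def)

lemma norm_matrix_matrix_mult_le:
  fixes A :: "real^'n^'m" and B :: "real^'p^'n"
  shows "norm (A ** B) \<le> norm A * norm B"
proof -
  have frob: "(norm M)\<^sup>2 = (\<Sum>i\<in>UNIV. (norm (M $ i))\<^sup>2)" for M :: "real^'a^'b"
    by (simp add: power2_norm_eq_inner inner_vec_def)
  have cols: "(norm B)\<^sup>2 = (\<Sum>j\<in>UNIV. (norm (column j B))\<^sup>2)"
    unfolding power2_norm_eq_inner inner_vec_def column_def by (subst sum.swap) simp
  have "(norm (A ** B))\<^sup>2 = (\<Sum>i\<in>UNIV. \<Sum>j\<in>UNIV. (A $ i \<bullet> column j B)\<^sup>2)"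
    unfolding frob power2_norm_eq_inner
    by (simp add: inner_vec_def matrix_matrix_mult_def column_def power2_eq_square)
  also have "\<dots> \<le> (\<Sum>i\<in>UNIV. \<Sum>j\<in>UNIV. (norm (A $ i))\<^sup>2 * (norm (column j B))\<^sup>2)"
    using Cauchy_Schwarz_ineq by (intro sum_mono) (simp add: power2_norm_eq_inner)
  also have "\<dots> = (norm A * norm B)\<^sup>2"
    by (simp add: power_mult_distrib frob[of A] cols sum_product)
  finally show ?thesis by (rule power2_le_imp_le) simp
qed

text \<open>
Cyclicity of the trace moves the leading \<open>transpose R\<close> to the end.
\<close>

lemma trace_congruence:
  fixes R :: "real^'n^'m" and D :: "real^'n^'n"
  defines "X \<equiv> R ** D ** transpose R" and "V \<equiv> transpose R ** R"
  shows "trace (V ** D) = trace X"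
    and "trace (V ** D ** V ** D) = trace (X ** X)"
    and "trace (V ** D ** V ** D ** V ** D) = trace (X ** X ** X)"
proof -
  show "trace (V ** D) = trace X"
    using trace_mul_sym[of "transpose R" "R ** D"] by (simp add: X_def V_def matrix_mul_assoc)
  show "trace (V ** D ** V ** D) = trace (X ** X)"
    using trace_mul_sym[of "transpose R" "R ** D ** transpose R ** R ** D"]
    by (simp add: X_def V_def matrix_mul_assoc)
  show "trace (V ** D ** V ** D ** V ** D) = trace (X ** X ** X)"
    using trace_mul_sym[of "transpose R" "R ** D ** transpose R ** R ** D ** transpose R ** R ** D"]
    by (simp add: X_def V_def matrix_mul_assoc)
qed

text \<open>
Cauchy-Schwarz for the Frobenius inner product, applied to \<open>X\<close> and the identity, and to \<open>X ** X\<close> and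
\<open>X\<close>. In terms of the eigenvalues these are the comparisons of power sums behind self-concordance.
\<close>

lemma symmetric_trace_bounds:
  fixes X :: "real^'n^'n"
  assumes "transpose X = X"
  shows "trace (X ** X) = (norm X)\<^sup>2"
    and "(trace X)\<^sup>2 \<le> real CARD('n) * (norm X)\<^sup>2"
    and "trace (X ** X ** X) \<le> norm X ^ 3"
proof -
  show "trace (X ** X) = (norm X)\<^sup>2"
    using trace_mult_transpose[of X X] assms by (simp add: power2_norm_eq_inner)
  have "trace X = X \<bullet> mat 1"
    using trace_mult_transpose[of X "mat 1"] by (simp add: transpose_mat)
  moreover have "(mat 1 :: real^'n^'n) \<bullet> mat 1 = real CARD('n)"
    using trace_mult_transpose[of "mat 1 :: real^'n^'n" "mat 1"] by (simp add: transpose_mat trace_I)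
  ultimately show "(trace X)\<^sup>2 \<le> real CARD('n) * (norm X)\<^sup>2"
    using Cauchy_Schwarz_ineq[of X "mat 1"] by (simp add: power2_norm_eq_inner mult.commute)
  have "trace (X ** X ** X) = (X ** X) \<bullet> X"
    using trace_mult_transpose[of "X ** X" X] assms by simp
  also have "\<dots> \<le> norm (X ** X) * norm X" by (rule norm_cauchy_schwarz)
  also have "\<dots> \<le> (norm X * norm X) * norm X"
    by (intro mult_right_mono norm_matrix_matrix_mult_le) simp
  finally show "trace (X ** X ** X) \<le> norm X ^ 3" by (simp add: power3_eq_cube)
qed

lemma square_powr_three_halves:
  assumes "0 \<le> (r::real)"
  shows "(r\<^sup>2) powr (3/2) = r ^ 3"
proof (cases "r = 0")
  case False
  then have "0 < r" using assms by simp
  then have "(r\<^sup>2) powr (3/2) = (r powr 2) powr (3/2)" by simp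
  also have "\<dots> = r powr 3" unfolding powr_powr by simp
  finally show ?thesis using \<open>0 < r\<close> by simp
qed simp

text \<open>
With \<open>V y = transpose R ** R\<close> the three derivatives along \<open>h\<close> are the traces of the powers of
\<open>R ** Diag h ** transpose R\<close>, with a factor 2 on the third.
\<close>

lemma self_concordant_barrier_of_matrix_field:
  fixes S :: "(real^'m) set" and f :: "real^'m \<Rightarrow> real" and V :: "real^'m \<Rightarrow> real^'m^'m"
  assumes "open S" "convex S" "closed (epigraph S f)"
    and f: "\<And>y. y \<in> S \<Longrightarrow> (f has_derivative (\<lambda>h. \<Sum>j\<in>UNIV. V y $ j $ j * h $ j)) (at y)"
    and V: "\<And>y i j. y \<in> S \<Longrightarrow> ((\<lambda>y. V y $ i $ j) has_derivative
          (\<lambda>h. \<Sum>k\<in>UNIV. V y $ i $ k * V y $ k $ j * h $ k)) (at y)"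
    and psd: "\<And>y. y \<in> S \<Longrightarrow> pos_semidef (V y)"
  shows "self_concordant_barrier S f (real CARD('m))"
proof -
  have der1: "three_times_differentiable_on S f"
    by (rule three_derivatives_of_matrix_field(1)[OF \<open>open S\<close> f V]) assumption+
  have der2: "D1 f y h = (\<Sum>j\<in>UNIV. V y $ j $ j * h $ j)"
    if "y \<in> S" for y h
    by (rule three_derivatives_of_matrix_field(2)[OF \<open>open S\<close> f V that])
  have der3: "D2 f y h = (\<Sum>j\<in>UNIV. \<Sum>i\<in>UNIV. V y $ j $ i * V y $ i $ j * h $ i * h $ j)"
    if "y \<in> S" for y h
    by (rule three_derivatives_of_matrix_field(3)[OF \<open>open S\<close> f V that])
  have der4: "D3 f y h = 2 * (\<Sum>j\<in>UNIV. \<Sum>i\<in>UNIV. \<Sum>l\<in>UNIV.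
        V y $ j $ i * V y $ i $ l * V y $ l $ j * h $ l * h $ i * h $ j)"
    if "y \<in> S" for y h
    by (rule three_derivatives_of_matrix_field(4)[OF \<open>open S\<close> f V that])
  have bounds: "\<exists>r\<ge>0. (D1 f y h)\<^sup>2 \<le> real CARD('m) * r\<^sup>2 \<and> D2 f y h = r\<^sup>2 \<and> D3 f y h \<le> 2 * r ^ 3"
    if y: "y \<in> S" for y h
  proof -
    obtain R :: "real^'m^'m" where R: "V y = transpose R ** R"
      by (rule pos_semidef_factor[OF psd[OF y]])
    let ?D = "Diag h" and ?X = "R ** Diag h ** transpose R"
    have "transpose ?D = ?D" by (simp add: Diag_def transpose_def vec_eq_iff)
    then have "transpose ?X = ?X"
      by (simp add: matrix_transpose_mul transpose_transpose matrix_mul_assoc)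
    note tr = symmetric_trace_bounds[OF this] trace_congruence[of R ?D, folded R]
    have "D1 f y h = trace (V y ** ?D)"
      unfolding der2[OF y] by (simp add: trace_def matrix_mult_Diag)
    moreover have "D2 f y h = trace (V y ** ?D ** V y ** ?D)"
      unfolding der3[OF y]
      by (simp add: trace_def matrix_mult_Diag matrix_matrix_mult_def[of "V y ** ?D" "V y"]
          sum_distrib_left mult_ac)
    moreover have "D3 f y h = 2 * trace (V y ** ?D ** V y ** ?D ** V y ** ?D)"
      unfolding der4[OF y]
      by (subst sum.swap) (simp add: trace_def matrix_mult_Diag matrix_matrix_mult_def[of "_ ** ?D" "V y"]
          sum_distrib_left sum_distrib_right mult_ac)
    ultimately show ?thesis using tr by (intro exI[of _ "norm ?X"]) auto
  qed
  show ?thesis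
    unfolding self_concordant_barrier_def self_concordant_def
  proof (intro conjI ballI allI)
    show "three_times_differentiable_on S f" by (rule der1)
    show "convex_on S f"
      using \<open>convex S\<close> der1
    proof (rule convex_on_if_D2_nonneg)
      fix y h assume "y \<in> S"
      then show "0 \<le> D2 f y h" using bounds[of y h] by auto
    qed
    fix y h assume "y \<in> S"
    from bounds[OF this, of h] obtain r where "0 \<le> r" "(D1 f y h)\<^sup>2 \<le> real CARD('m) * r\<^sup>2"
      "D2 f y h = r\<^sup>2" "D3 f y h \<le> 2 * r ^ 3" by blast
    then show "D3 f y h \<le> 2 * D2 f y h powr (3/2)" "(D1 f y h)\<^sup>2 \<le> real CARD('m) * D2 f y h"
      by (simp_all add: square_powr_three_halves)
  qed fact+
qed

section \<open>The barrier for general data\<close>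

lemma transpose_slack_matrix:
  fixes C :: "real^'n^'n" and A :: "real^'n^'m"
  assumes "transpose C = C"
  shows "transpose (C - transpose A ** Diag y ** A) = C - transpose A ** Diag y ** A"
proof -
  have minus: "transpose (X - Y) = transpose X - transpose Y" for X Y :: "real^'n^'n"
    by (simp add: transpose_def vec_eq_iff)
  have "transpose (Diag y) = Diag y" by (simp add: Diag_def transpose_def vec_eq_iff)
  then show ?thesis
    using assms by (simp add: minus matrix_transpose_mul transpose_transpose matrix_mul_assoc)
qed

lemma quadratic_form_slack_matrix:
  fixes C :: "real^'n^'n" and A :: "real^'n^'m"
  shows "x \<bullet> ((C - transpose A ** Diag y ** A) *v x) = x \<bullet> (C *v x) - (\<Sum>j\<in>UNIV. y $ j * ((A *v x) $ j)\<^sup>2)"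
proof -
  have diag: "Diag y *v u = (\<chi> j. y $ j * u $ j)" for u :: "real^'m"
    by (simp add: Diag_def matrix_vector_mult_def vec_eq_iff if_distrib if_distribR cong: if_cong)
  have "x \<bullet> ((transpose A ** Diag y ** A) *v x) = (A *v x) \<bullet> (Diag y *v (A *v x))"
    using inner_matrix_vector_transpose[of x "transpose A" "Diag y *v (A *v x)"]
    by (simp add: transpose_transpose flip: matrix_vector_mul_assoc)
  also have "\<dots> = (\<Sum>j\<in>UNIV. y $ j * ((A *v x) $ j)\<^sup>2)"
    by (simp add: diag inner_vec_def power2_eq_square mult_ac)
  finally show ?thesis
    by (simp add: matrix_vector_mult_diff_rdistrib inner_diff_right)
qed

lemma dom_zeta_quadratic:
  fixes C :: "real^'n^'n" and A :: "real^'n^'m"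
  assumes "transpose C = C"
  shows "y \<in> dom_zeta C A \<longleftrightarrow> (\<forall>x. x \<noteq> 0 \<longrightarrow> (\<Sum>j\<in>UNIV. y $ j * ((A *v x) $ j)\<^sup>2) < x \<bullet> (C *v x))"
  by (simp add: dom_zeta_def pos_def_def quadratic_form_slack_matrix transpose_slack_matrix[OF assms])

lemma bounded_linear_congruence_Diag:
  fixes A :: "real^'n^'m"
  shows "bounded_linear (\<lambda>h. transpose A ** Diag h ** A)"
proof -
  have "linear (Diag :: real^'m \<Rightarrow> real^'m^'m)"
    by (rule linearI) (simp_all add: Diag_def vec_eq_iff)
  then have "bounded_linear (Diag :: real^'m \<Rightarrow> real^'m^'m)"
    by (simp add: linear_conv_bounded_linear)
  from bounded_linear_compose[OF bounded_bilinear.bounded_linear_left[OF bounded_bilinear_matrix_matrix_mult]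
      bounded_linear_compose[OF bounded_bilinear.bounded_linear_right[OF bounded_bilinear_matrix_matrix_mult] this]]
  show ?thesis .
qed

lemma has_derivative_slack_matrix:
  "((\<lambda>y. C - transpose A ** Diag y ** A) has_derivative (\<lambda>h. - (transpose A ** Diag h ** A))) (at y)"
  using has_derivative_diff[OF has_derivative_const bounded_linear_imp_has_derivative[OF bounded_linear_congruence_Diag]]
  by simp

text \<open>
Its diagonal is the gradient of \<open>zeta C A\<close>, its entrywise square the Hessian.
\<close>

definition grad_matrix :: "real^'n^'n \<Rightarrow> real^'n^'m \<Rightarrow> real^'m \<Rightarrow> real^'m^'m" where
  "grad_matrix C A y = A ** matrix_inv (C - transpose A ** Diag y ** A) ** transpose A"

lemma pos_semidef_grad_matrix:
  "y \<in> dom_zeta C A \<Longrightarrow> pos_semidef (grad_matrix C A y)"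
  by (simp add: grad_matrix_def dom_zeta_def pos_semidef_congruence pos_def_imp_pos_semidef
      pos_def_matrix_inv)

lemma has_derivative_zeta:
  fixes C :: "real^'n^'n" and A :: "real^'n^'m"
  assumes "y \<in> dom_zeta C A"
  shows "(zeta C A has_derivative (\<lambda>h. \<Sum>j\<in>UNIV. grad_matrix C A y $ j $ j * h $ j)) (at y)"
proof -
  let ?K = "\<lambda>y. C - transpose A ** Diag y ** A"
  have pd: "pos_def (?K y)" using assms by (simp add: dom_zeta_def)
  note inv = pos_def_invertible[OF pd] and det_pos = pos_def_det_pos[OF pd]
  have "((\<lambda>y. det (?K y)) has_derivative
      (\<lambda>h. det (?K y) * trace (matrix_inv (?K y) ** (- (transpose A ** Diag h ** A))))) (at y)"
    using diff_chain_at[OF has_derivative_slack_matrix has_derivative_det[OF inv]] by (simp add: o_def)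
  from has_derivative_minus[OF has_derivative_ln[OF det_pos this]]
  have "(zeta C A has_derivative (\<lambda>h. - (det (?K y) *
      trace (matrix_inv (?K y) ** (- (transpose A ** Diag h ** A))) * inverse (det (?K y))))) (at y)"
    by (simp add: zeta_def[abs_def])
  moreover have "- (det (?K y) * trace (matrix_inv (?K y) ** (- (transpose A ** Diag h ** A)))
      * inverse (det (?K y))) = (\<Sum>j\<in>UNIV. grad_matrix C A y $ j $ j * h $ j)" for h
  proof -
    interpret mult: bounded_bilinear "(**) :: real^'n^'n \<Rightarrow> real^'n^'n \<Rightarrow> real^'n^'n"
      by (rule bounded_bilinear_matrix_matrix_mult)
    have "trace (matrix_inv (?K y) ** (- (transpose A ** Diag h ** A)))
        = - trace (matrix_inv (?K y) ** transpose A ** Diag h ** A)"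
      by (simp add: mult.minus_right trace_def sum_negf matrix_mul_assoc)
    also have "trace (matrix_inv (?K y) ** transpose A ** Diag h ** A) = trace (grad_matrix C A y ** Diag h)"
      using trace_mul_sym[of "matrix_inv (?K y) ** transpose A ** Diag h" A]
      by (simp add: grad_matrix_def matrix_mul_assoc)
    finally show ?thesis using det_pos by (simp add: trace_def matrix_mult_Diag)
  qed
  ultimately show ?thesis by simp
qed

lemma has_derivative_grad_matrix:
  fixes C :: "real^'n^'n" and A :: "real^'n^'m"
  assumes "y \<in> dom_zeta C A"
  shows "((\<lambda>y. grad_matrix C A y $ i $ j) has_derivative
    (\<lambda>h. \<Sum>k\<in>UNIV. grad_matrix C A y $ i $ k * grad_matrix C A y $ k $ j * h $ k)) (at y)"
proof -
  let ?K = "\<lambda>y. C - transpose A ** Diag y ** A"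
  let ?W = "matrix_inv (?K y)"
  have inv: "invertible (?K y)" using assms by (simp add: dom_zeta_def pos_def_invertible)
  interpret square: bounded_bilinear "(**) :: real^'n^'n \<Rightarrow> real^'n^'n \<Rightarrow> real^'n^'n"
    by (rule bounded_bilinear_matrix_matrix_mult)
  have "((\<lambda>y. matrix_inv (?K y)) has_derivative
      (\<lambda>h. - (?W ** (- (transpose A ** Diag h ** A)) ** ?W))) (at y)"
    using diff_chain_at[OF has_derivative_slack_matrix has_derivative_matrix_inv[OF inv]]
    by (simp add: o_def)
  moreover have "bounded_linear (\<lambda>M :: real^'n^'n. A ** M ** transpose A)"
    using bounded_linear_compose[OF
        bounded_bilinear.bounded_linear_left[OF bounded_bilinear_matrix_matrix_mult, of "transpose A"]
        bounded_bilinear.bounded_linear_right[OF bounded_bilinear_matrix_matrix_mult, of A]] .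
  ultimately have "((\<lambda>y. A ** matrix_inv (?K y) ** transpose A) has_derivative
      (\<lambda>h. A ** (- (?W ** (- (transpose A ** Diag h ** A)) ** ?W)) ** transpose A)) (at y)"
    by (rule bounded_linear.has_derivative[rotated])
  then have der: "(grad_matrix C A has_derivative
      (\<lambda>h. grad_matrix C A y ** Diag h ** grad_matrix C A y)) (at y)"
    by (simp add: grad_matrix_def[abs_def] square.minus_left square.minus_right matrix_mul_assoc)
  have "bounded_linear (\<lambda>M :: real^'m^'m. M $ i $ j)"
    by (intro bounded_linear_compose[OF bounded_linear_vec_nth] bounded_linear_vec_nth)
  from bounded_linear.has_derivative[OF this der] show ?thesis
    by (simp add: matrix_matrix_mult_def[of "_ ** Diag _"] matrix_mult_Diag mult_ac)
qed

lemma convex_dom_zeta: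
  fixes C :: "real^'n^'n" and A :: "real^'n^'m"
  assumes "transpose C = C"
  shows "convex (dom_zeta C A)"
  unfolding convex_def
proof (intro ballI allI impI)
  fix y z :: "real^'m" and u v :: real
  assume y: "y \<in> dom_zeta C A" and z: "z \<in> dom_zeta C A" and uv: "0 \<le> u" "0 \<le> v" "u + v = 1"
  show "u *\<^sub>R y + v *\<^sub>R z \<in> dom_zeta C A"
    unfolding dom_zeta_quadratic[OF assms]
  proof (intro allI impI)
    fix x :: "real^'n" assume "x \<noteq> 0"
    let ?q = "\<lambda>y. \<Sum>j\<in>UNIV. y $ j * ((A *v x) $ j)\<^sup>2"
    have "?q y < x \<bullet> (C *v x)" "?q z < x \<bullet> (C *v x)"
      using y z \<open>x \<noteq> 0\<close> unfolding dom_zeta_quadratic[OF assms] by blast+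
    then have "u * ?q y + v * ?q z < x \<bullet> (C *v x)"
      by (rule convex_bound_lt[OF _ _ uv])
    moreover have "?q (u *\<^sub>R y + v *\<^sub>R z) = u * ?q y + v * ?q z"
      by (simp add: sum_distrib_left sum.distrib[symmetric] distrib_right mult.assoc)
    ultimately show "?q (u *\<^sub>R y + v *\<^sub>R z) < x \<bullet> (C *v x)" by simp
  qed
qed

lemma continuous_on_slack_matrix: "continuous_on S (\<lambda>y. C - transpose A ** Diag y ** A)"
  by (intro continuous_intros linear_continuous_on bounded_linear_congruence_Diag)

lemma norm_matrix_vector_mult_le:
  fixes M :: "real^'n^'m"
  shows "norm (M *v x) \<le> norm M * norm x"
proof -
  have col: "norm (columnvector v :: real^1^'k) = norm v" for v :: "real^'k"
    by (simp add: norm_vec_def columnvector_def L2_set_def)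
  show ?thesis
    using norm_matrix_matrix_mult_le[of M "columnvector x :: real^1^'n"]
    unfolding dot_rowvector_columnvector[symmetric] col .
qed

text \<open>
The quadratic form of \<open>M\<close> has a positive minimum on the compact unit sphere, which a smaller
perturbation cannot cancel.
\<close>

lemma pos_def_perturb:
  fixes M :: "real^'n^'n"
  assumes "pos_def M"
  obtains c where "0 < c" "\<And>N. transpose N = N \<Longrightarrow> norm (N - M) < c \<Longrightarrow> pos_def N"
proof -
  have cont: "continuous_on (sphere 0 1) (\<lambda>x. x \<bullet> (M *v x))"
    by (intro continuous_intros linear_continuous_on matrix_vector_mul_bounded_linear)
  have "(axis undefined 1 :: real^'n) \<in> sphere 0 1" by simp
  then have "sphere (0 :: real^'n) 1 \<noteq> {}" by blast
  from continuous_attains_inf[OF compact_sphere this cont] obtain x0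
    where x0: "x0 \<in> sphere 0 1" and min: "\<And>x. x \<in> sphere 0 1 \<Longrightarrow> x0 \<bullet> (M *v x0) \<le> x \<bullet> (M *v x)"
    by blast
  show ?thesis
  proof
    have "x0 \<noteq> 0" using x0 by auto
    then show pos: "0 < x0 \<bullet> (M *v x0)" using assms by (simp add: pos_def_def)
    fix N assume N: "transpose N = N" "norm (N - M) < x0 \<bullet> (M *v x0)"
    have "0 < x \<bullet> (N *v x)" if "x \<noteq> 0" for x
    proof -
      let ?u = "x /\<^sub>R norm x"
      have u: "norm ?u = 1" using that by simp
      have "norm ((N - M) *v ?u) \<le> norm (N - M)"
        using norm_matrix_vector_mult_le[of "N - M" ?u] u by simp
      then have "\<bar>?u \<bullet> ((N - M) *v ?u)\<bar> \<le> norm (N - M)"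
        using Cauchy_Schwarz_ineq2[of ?u "(N - M) *v ?u"] unfolding u by linarith
      then have "0 < ?u \<bullet> (M *v ?u) + ?u \<bullet> ((N - M) *v ?u)"
        using min[of ?u] N(2) u by (simp only: mem_sphere_0) linarith
      also have "\<dots> = ?u \<bullet> (N *v ?u)"
        by (simp add: matrix_vector_mult_diff_rdistrib inner_diff_right)
      also have "\<dots> = (x \<bullet> (N *v x)) / (norm x)\<^sup>2"
        by (simp add: matrix_vector_mult_scaleR power2_eq_square divide_inverse mult_ac)
      finally show ?thesis using that by (simp add: zero_less_divide_iff)
    qed
    with N(1) show "pos_def N" by (simp add: pos_def_def)
  qed
qed

lemma open_dom_zeta:
  fixes C :: "real^'n^'n" and A :: "real^'n^'m"
  assumes "transpose C = C"
  shows "open (dom_zeta C A)"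
  unfolding open_contains_ball
proof
  fix y assume y: "y \<in> dom_zeta C A"
  let ?K = "\<lambda>y. C - transpose A ** Diag y ** A"
  obtain c where "0 < c" and c: "\<And>N. transpose N = N \<Longrightarrow> norm (N - ?K y) < c \<Longrightarrow> pos_def N"
    using pos_def_perturb y unfolding dom_zeta_def by blast
  have "continuous (at y) ?K"
    using continuous_on_slack_matrix[of UNIV C A] by (simp add: continuous_on_eq_continuous_at)
  then obtain d where "0 < d" and d: "\<And>z. dist z y < d \<Longrightarrow> dist (?K z) (?K y) < c"
    using \<open>0 < c\<close> unfolding continuous_at_eps_delta by blast
  have "ball y d \<subseteq> dom_zeta C A"
  proof
    fix z assume "z \<in> ball y d"
    then have "dist (?K z) (?K y) < c" using d[of z] by (simp only: mem_ball dist_commute)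
    then have "norm (?K z - ?K y) < c" by (simp only: dist_norm)
    then show "z \<in> dom_zeta C A" using c[OF transpose_slack_matrix[OF assms]] by (simp add: dom_zeta_def)
  qed
  with \<open>0 < d\<close> show "\<exists>e>0. ball y e \<subseteq> dom_zeta C A" by blast
qed

text \<open>
On a bounded-above part of the epigraph the determinant stays away from 0, so a limit of positive
definite matrices is positive semidefinite and invertible. Membership in the epigraph is therefore
a conjunction of weak inequalities between continuous functions.
\<close>

lemma closed_epigraph_zeta:
  fixes C :: "real^'n^'n" and A :: "real^'n^'m"
  assumes "transpose C = C"
  shows "closed (epigraph (dom_zeta C A) (zeta C A))"
proof -
  let ?K = "\<lambda>y. C - transpose A ** Diag y ** A"
  have mem: "(y, t) \<in> epigraph (dom_zeta C A) (zeta C A) \<longleftrightarrow>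
      (\<forall>x. 0 \<le> x \<bullet> (?K y *v x)) \<and> exp (- t) \<le> det (?K y)" for y t
  proof
    assume "(y, t) \<in> epigraph (dom_zeta C A) (zeta C A)"
    then have pd: "pos_def (?K y)" and le: "- ln (det (?K y)) \<le> t"
      by (auto simp: epigraph_def dom_zeta_def zeta_def)
    have "exp (- t) \<le> exp (ln (det (?K y)))" using le by simp
    then show "(\<forall>x. 0 \<le> x \<bullet> (?K y *v x)) \<and> exp (- t) \<le> det (?K y)"
      using pos_def_det_pos[OF pd] pos_def_imp_pos_semidef[OF pd] by (simp add: pos_semidef_def)
  next
    assume *: "(\<forall>x. 0 \<le> x \<bullet> (?K y *v x)) \<and> exp (- t) \<le> det (?K y)"
    then have psd: "pos_semidef (?K y)" and le: "exp (- t) \<le> det (?K y)"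
      unfolding pos_semidef_def transpose_slack_matrix[OF assms] by blast+
    have "0 < det (?K y)" using le exp_gt_zero[of "- t"] by linarith
    then have "pos_def (?K y)"
      using psd by (intro pos_semidef_invertible_imp_pos_def) (auto simp: invertible_det_nz)
    moreover have "- t \<le> ln (det (?K y))"
      using le \<open>0 < det (?K y)\<close> by (simp add: ln_ge_iff)
    ultimately show "(y, t) \<in> epigraph (dom_zeta C A) (zeta C A)"
      by (simp add: epigraph_def dom_zeta_def zeta_def)
  qed
  have "p \<in> epigraph (dom_zeta C A) (zeta C A) \<longleftrightarrow>
      p \<in> {p. \<forall>x. 0 \<le> x \<bullet> (?K (fst p) *v x)} \<inter> {p. exp (- snd p) \<le> det (?K (fst p))}" for p
    using mem[of "fst p" "snd p"] by simp
  then have "epigraph (dom_zeta C A) (zeta C A) =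
      {p. \<forall>x. 0 \<le> x \<bullet> (?K (fst p) *v x)} \<inter> {p. exp (- snd p) \<le> det (?K (fst p))}"
    by (rule set_eqI)
  moreover have K_cont: "continuous_on UNIV (\<lambda>p :: (real^'m) \<times> real. ?K (fst p))"
    by (rule continuous_on_compose2[OF continuous_on_slack_matrix[of UNIV]]) (auto intro: continuous_intros)
  have "closed {p :: (real^'m) \<times> real. \<forall>x. 0 \<le> x \<bullet> (?K (fst p) *v x)}"
    unfolding quadratic_form_slack_matrix
    by (intro closed_Collect_all closed_Collect_le continuous_intros)
  moreover have "closed {p :: (real^'m) \<times> real. exp (- snd p) \<le> det (?K (fst p))}"
    by (intro closed_Collect_le continuous_intros continuous_on_compose2[OF continuous_on_det K_cont]) auto
  ultimately show ?thesis by (simp add: closed_Int)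
qed

theorem zeta_self_concordant_barrier:
  fixes C :: "real^'n^'n" and A :: "real^'n^'m"
  assumes "transpose C = C"
  shows "self_concordant_barrier (dom_zeta C A) (zeta C A) (real CARD('m))"
  by (rule self_concordant_barrier_of_matrix_field[OF open_dom_zeta[OF assms] convex_dom_zeta[OF assms]
        closed_epigraph_zeta[OF assms] has_derivative_zeta has_derivative_grad_matrix
        pos_semidef_grad_matrix])

section \<open>Optimality of the parameter on the reduced domain\<close>

lemma dom_zeta_mat_1: "dom_zeta H (mat 1) = {y. Diag y \<prec>\<^sub>L H}"
  by (simp add: dom_zeta_def loewner_less_def transpose_mat)

lemma zeta_mat_1: "zeta H (mat 1) y = - ln (det (H - Diag y))"
  by (simp add: zeta_def transpose_mat)

text \<open>
The domain contains the nonpositive orthant, and raising coordinate \<open>i\<close> of \<open>(-t, \<dots>, -t)\<close> to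
\<open>H $ i $ i\<close> leaves it, as the unit vector \<open>axis i 1\<close> shows. So \<open>\<nu> \<ge> (\<Sum>i. t / (t + H $ i $ i))\<close> for every
\<open>t > 0\<close>, and large \<open>t\<close> gives the claim.
\<close>

lemma barrier_parameter_dom_zeta_mat_1:
  fixes H :: "real^'m^'m"
  assumes "pos_def H" and bar: "self_concordant_barrier (dom_zeta H (mat 1)) F \<nu>"
  shows "real CARD('m) \<le> \<nu>"
proof (rule ccontr)
  assume "\<not> real CARD('m) \<le> \<nu>"
  define \<delta> where "\<delta> = real CARD('m) - \<nu>"
  have "0 < \<delta>" using \<open>\<not> real CARD('m) \<le> \<nu>\<close> by (simp add: \<delta>_def)
  have sym: "transpose H = H" using assms(1) by (simp add: pos_def_def)
  have axis: "axis i 1 \<bullet> (H *v axis i 1) = H $ i $ i" for i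
    by (simp add: matrix_vector_mult_basis column_def inner_axis')
  have axis_neq_0: "(axis i 1 :: real^'m) \<noteq> 0" for i by (simp add: axis_eq_0_iff)
  have diag_pos: "0 < H $ i $ i" for i
    using assms(1) axis_neq_0[of i] axis[of i] unfolding pos_def_def by fastforce
  define g where "g = (\<Sum>i\<in>UNIV. H $ i $ i)"
  have diag_le: "H $ i $ i \<le> g" for i
    unfolding g_def using diag_pos by (intro member_le_sum) (auto simp: less_imp_le)
  have "0 < g" using diag_pos diag_le by (meson less_le_trans)
  \<comment> \<open>large enough to contradict \<open>\<delta> * t \<le> \<nu> * g\<close>, the bound after clearing denominators\<close>
  define t where "t = (\<bar>\<nu>\<bar> * g + 1) / \<delta>"
  have "0 < t" using \<open>0 < \<delta>\<close> \<open>0 < g\<close> by (simp add: t_def add_nonneg_pos)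
  define x :: "real^'m" where "x = (\<chi> i. - t)"
  have nonpos: "y \<in> dom_zeta H (mat 1)" if "\<And>i. y $ i \<le> 0" for y
    unfolding dom_zeta_quadratic[OF sym]
  proof (intro allI impI)
    fix u :: "real^'m" assume "u \<noteq> 0"
    have "(\<Sum>j\<in>UNIV. y $ j * ((mat 1 *v u) $ j)\<^sup>2) \<le> 0"
      using that by (intro sum_nonpos) (simp add: mult_nonpos_nonneg)
    also have "0 < u \<bullet> (H *v u)" using assms(1) \<open>u \<noteq> 0\<close> by (simp add: pos_def_def)
    finally show "(\<Sum>j\<in>UNIV. y $ j * ((mat 1 *v u) $ j)\<^sup>2) < u \<bullet> (H *v u)" .
  qed
  have exit: "x + (t + H $ i $ i) *\<^sub>R axis i 1 \<notin> dom_zeta H (mat 1)" for i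
  proof
    assume "x + (t + H $ i $ i) *\<^sub>R axis i 1 \<in> dom_zeta H (mat 1)"
    then have "(\<Sum>j\<in>UNIV. (x + (t + H $ i $ i) *\<^sub>R axis i 1) $ j * ((mat 1 *v axis i 1) $ j)\<^sup>2)
        < axis i 1 \<bullet> (H *v axis i 1)"
      unfolding dom_zeta_quadratic[OF sym] using axis_neq_0 by blast
    moreover have "(\<Sum>j\<in>UNIV. (x + (t + H $ i $ i) *\<^sub>R axis i 1) $ j * ((mat 1 *v axis i 1) $ j)\<^sup>2)
        = (\<Sum>j\<in>UNIV. if j = i then H $ i $ i else 0)"
      by (intro sum.cong) (auto simp: x_def axis_def)
    ultimately show False by (simp add: axis)
  qed
  have "0 < t / (t + H $ i $ i)" for i
    using \<open>0 < t\<close> diag_pos[of i] by (simp add: add_pos_pos)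
  then have sum_pos: "0 < (\<Sum>i\<in>UNIV. t / (t + H $ i $ i))"
    by (intro sum_pos) auto
  have "x + (\<Sum>i\<in>UNIV. t *\<^sub>R axis i 1) = 0"
    by (simp add: vec_eq_iff x_def axis_def if_distrib cong: if_cong)
  then have origin: "x + (\<Sum>i\<in>UNIV. t *\<^sub>R axis i 1) \<in> dom_zeta H (mat 1)"
    by (simp add: nonpos)
  have "real CARD('m) * (t / (t + g)) \<le> (\<Sum>i\<in>UNIV. t / (t + H $ i $ i))"
    using diag_le diag_pos \<open>0 < t\<close> 
    by (intro sum_bounded_below frac_le) (auto simp: add_pos_pos)
  also have "\<dots> \<le> \<nu>"
  proof (rule barrier_parameter_lower_bound[OF bar, where x = x and p = "\<lambda>i. axis i 1"])
    show "x \<in> dom_zeta H (mat 1)" using \<open>0 < t\<close> by (intro nonpos) (simp add: x_def)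
    show "x - s *\<^sub>R axis i 1 \<in> dom_zeta H (mat 1)" if "0 \<le> s" for s i
      using \<open>0 < t\<close> that by (intro nonpos) (simp add: x_def axis_def)
    show "0 < t + H $ i $ i" for i using \<open>0 < t\<close> diag_pos[of i] by simp
  qed (use exit origin sum_pos \<open>0 < t\<close> in auto)
  finally have "real CARD('m) * t \<le> \<nu> * (t + g)"
    using \<open>0 < t\<close> \<open>0 < g\<close> by (simp add: field_simps)
  then have "\<delta> * t \<le> \<nu> * g" by (simp add: \<delta>_def algebra_simps)
  also have "\<dots> \<le> \<bar>\<nu>\<bar> * g" using \<open>0 < g\<close> by (intro mult_right_mono) auto
  finally have "\<delta> * t \<le> \<bar>\<nu>\<bar> * g" .
  moreover have "\<delta> * t = \<bar>\<nu>\<bar> * g + 1" using \<open>0 < \<delta>\<close> by (simp add: t_def)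
  ultimately show False by simp
qed

section \<open>Reduction to the smaller matrix\<close>

context
  fixes C :: "real^'n^'n" and A :: "real^'n^'m" and G :: "real^'m^'m"
  assumes C: "pos_def C" and rank: "rank A = CARD('m)"
    and G: "G = A ** matrix_inv C ** transpose A"
begin

text \<open>
Full row rank makes \<open>transpose A\<close> injective.
\<close>

lemma pos_def_weighted_gram: "pos_def G"
  unfolding pos_def_def
proof (intro conjI allI impI)
  have "pos_semidef G"
    unfolding G by (intro pos_semidef_congruence pos_def_imp_pos_semidef pos_def_matrix_inv C)
  then show "transpose G = G" by (simp add: pos_semidef_def)
  fix x :: "real^'m" assume "x \<noteq> 0"
  obtain z where z: "x = A *v z" using rank by (metis full_rank_surjective surjD)
  have "x \<bullet> x = (transpose A *v x) \<bullet> z"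
    using inner_matrix_vector_transpose[of x A z] z by simp
  then have "transpose A *v x \<noteq> 0" using \<open>x \<noteq> 0\<close> by auto
  then have "0 < (transpose A *v x) \<bullet> (matrix_inv C *v (transpose A *v x))"
    using pos_def_matrix_inv[OF C] by (simp add: pos_def_def)
  also have "\<dots> = x \<bullet> (G *v x)"
    using inner_matrix_vector_transpose[of x A "matrix_inv C *v (transpose A *v x)"]
    by (simp only: G matrix_vector_mul_assoc matrix_mul_assoc)
  finally show "0 < x \<bullet> (G *v x)" .
qed

text \<open>
\<open>P *v x\<close> is the minimizer of \<open>z \<bullet> (C *v z)\<close> under the constraint \<open>A *v z = x\<close>, and the remainder
\<open>z - P *v (A *v z)\<close> lies in the kernel of \<open>A\<close>, which is \<open>C\<close>-orthogonal to the range of \<open>P\<close>.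
\<close>

lemma quadratic_form_decomposition:
  defines "P \<equiv> matrix_inv C ** transpose A ** matrix_inv G"
  shows "A ** P = mat 1"
    and "z \<bullet> (C *v z) = (z - P *v (A *v z)) \<bullet> (C *v (z - P *v (A *v z)))
      + (A *v z) \<bullet> (matrix_inv G *v (A *v z))"
proof -
  note C_inv = matrix_inv_inverse[OF pos_def_invertible[OF C]]
  note G_inv = matrix_inv_inverse[OF pos_def_invertible[OF pos_def_weighted_gram]]
  have AP: "A ** P = G ** matrix_inv G" by (simp add: P_def G matrix_mul_assoc)
  then show AP1: "A ** P = mat 1" using G_inv by simp
  have CP: "C ** P = transpose A ** matrix_inv G"
    by (simp add: P_def matrix_mul_assoc C_inv)
  have symC: "transpose C = C" using C by (simp add: pos_def_def)
  define x where "x = A *v z"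
  define w where "w = z - P *v x"
  have APv: "A *v (P *v u) = u" for u by (simp only: matrix_vector_mul_assoc AP1 matrix_vector_mul_lid)
  then have "A *v w = 0" by (simp add: w_def matrix_vector_mult_diff_distrib x_def)
  have CPx: "u \<bullet> (C *v (P *v x)) = (A *v u) \<bullet> (matrix_inv G *v x)" for u
    using inner_matrix_vector_transpose[of u "transpose A" "matrix_inv G *v x"]
    by (simp only: matrix_vector_mul_assoc CP transpose_transpose)
  have "(P *v x) \<bullet> (C *v w) = w \<bullet> (C *v (P *v x))"
    using inner_matrix_vector_transpose[of "P *v x" C w] unfolding symC by (simp only: inner_commute)
  also have "\<dots> = 0" using CPx[of w] \<open>A *v w = 0\<close> by simp
  finally have "(P *v x) \<bullet> (C *v w) = 0" .
  moreover have "w \<bullet> (C *v (P *v x)) = 0" using CPx[of w] \<open>A *v w = 0\<close> by simp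
  moreover have "(P *v x) \<bullet> (C *v (P *v x)) = x \<bullet> (matrix_inv G *v x)"
    using CPx[of "P *v x"] by (simp only: APv)
  moreover have "z = w + P *v x" by (simp add: w_def)
  ultimately have "z \<bullet> (C *v z) = w \<bullet> (C *v w) + x \<bullet> (matrix_inv G *v x)"
    by (simp add: matrix_vector_right_distrib inner_add_left inner_add_right)
  then show "z \<bullet> (C *v z) = (z - P *v (A *v z)) \<bullet> (C *v (z - P *v (A *v z)))
      + (A *v z) \<bullet> (matrix_inv G *v (A *v z))"
    by (simp only: w_def x_def)
qed

text \<open>
One inclusion tests the form on the minimizers \<open>P *v x\<close>, the other drops the nonnegative remainder.
\<close>

lemma dom_zeta_reduction: "dom_zeta C A = dom_zeta (matrix_inv G) (mat 1)"
proof (intro set_eqI iffI)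
  have symC: "transpose C = C" using C by (simp add: pos_def_def)
  have symH: "transpose (matrix_inv G) = matrix_inv G"
    using pos_def_matrix_inv[OF pos_def_weighted_gram] by (simp add: pos_def_def)
  let ?P = "matrix_inv C ** transpose A ** matrix_inv G"
  let ?q = "\<lambda>y x :: real^'m. \<Sum>j\<in>UNIV. y $ j * (x $ j)\<^sup>2"
  note decomp = quadratic_form_decomposition
  {
    fix y assume y: "y \<in> dom_zeta C A"
    show "y \<in> dom_zeta (matrix_inv G) (mat 1)"
      unfolding dom_zeta_quadratic[OF symH]
    proof (intro allI impI)
      fix x :: "real^'m" assume "x \<noteq> 0"
      have Ax: "A *v (?P *v x) = x"
        unfolding matrix_vector_mul_assoc decomp(1) by simp
      then have "?P *v x \<noteq> 0" using \<open>x \<noteq> 0\<close> by auto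
      then have "?q y (A *v (?P *v x)) < (?P *v x) \<bullet> (C *v (?P *v x))"
        using y unfolding dom_zeta_quadratic[OF symC] by blast
      also have "\<dots> = x \<bullet> (matrix_inv G *v x)"
        unfolding decomp(2)[of "?P *v x"] Ax by simp
      finally show "?q y (mat 1 *v x) < x \<bullet> (matrix_inv G *v x)" unfolding Ax by simp
    qed
  }
  {
    fix y assume y: "y \<in> dom_zeta (matrix_inv G) (mat 1)"
    have y': "?q y x < x \<bullet> (matrix_inv G *v x)" if "x \<noteq> 0" for x
      using y that unfolding dom_zeta_quadratic[OF symH] by simp
    show "y \<in> dom_zeta C A"
      unfolding dom_zeta_quadratic[OF symC]
    proof (intro allI impI)
      fix z :: "real^'n" assume "z \<noteq> 0"
      let ?w = "z - ?P *v (A *v z)"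
      show "?q y (A *v z) < z \<bullet> (C *v z)"
      proof (cases "A *v z = 0")
        case True
        then show ?thesis using C \<open>z \<noteq> 0\<close> by (simp add: pos_def_def)
      next
        case False
        have "0 \<le> ?w \<bullet> (C *v ?w)"
          using pos_def_imp_pos_semidef[OF C] unfolding pos_semidef_def by blast
        then show ?thesis unfolding decomp(2)[of z] using y'[OF False] by linarith
      qed
    qed
  }
qed

text \<open>
Woodbury's identity for \<open>K = C - transpose A ** Diag y ** A\<close>: multiply
\<open>K ** matrix_inv C ** transpose A = transpose A ** (matrix_inv G - Diag y) ** G\<close> by
\<open>A ** matrix_inv K\<close> from the left and cancel \<open>G\<close>.
\<close>

lemma grad_matrix_reduction:
  assumes y: "y \<in> dom_zeta C A"
  shows "grad_matrix C A y = grad_matrix (matrix_inv G) (mat 1) y"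
proof -
  let ?K = "C - transpose A ** Diag y ** A"
  let ?H = "matrix_inv G"
  let ?V = "grad_matrix C A y"
  interpret nm: bounded_bilinear "(**) :: real^'n^'n \<Rightarrow> real^'m^'n \<Rightarrow> real^'m^'n"
    by (rule bounded_bilinear_matrix_matrix_mult)
  interpret mm: bounded_bilinear "(**) :: real^'m^'m \<Rightarrow> real^'m^'m \<Rightarrow> real^'m^'m"
    by (rule bounded_bilinear_matrix_matrix_mult)
  interpret nmm: bounded_bilinear "(**) :: real^'m^'n \<Rightarrow> real^'m^'m \<Rightarrow> real^'m^'n"
    by (rule bounded_bilinear_matrix_matrix_mult)
  note C_inv = matrix_inv_inverse[OF pos_def_invertible[OF C]]
  note G_inv = matrix_inv_inverse[OF pos_def_invertible[OF pos_def_weighted_gram]]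
  have "invertible ?K" using y by (simp add: dom_zeta_def pos_def_invertible)
  note K_inv = matrix_inv_inverse[OF this]
  have "?K ** (matrix_inv C ** transpose A) = transpose A - transpose A ** Diag y ** G"
    unfolding nm.diff_left by (simp add: matrix_mul_assoc C_inv G)
  also have "\<dots> = transpose A ** ((?H - Diag y) ** G)"
    unfolding mm.diff_left nmm.diff_right G_inv by (simp add: matrix_mul_assoc)
  finally have "matrix_inv ?K ** (?K ** (matrix_inv C ** transpose A))
      = matrix_inv ?K ** (transpose A ** ((?H - Diag y) ** G))" by simp
  then have "matrix_inv C ** transpose A = matrix_inv ?K ** (transpose A ** ((?H - Diag y) ** G))"
    by (simp add: matrix_mul_assoc[of "matrix_inv ?K" ?K] K_inv)
  then have "G = ?V ** (?H - Diag y) ** G"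
    by (simp add: G matrix_mul_assoc[symmetric] grad_matrix_def)
  then have "G ** ?H = ?V ** (?H - Diag y) ** G ** ?H" by simp
  then have "?V ** (?H - Diag y) = mat 1"
    by (simp add: matrix_mul_assoc[symmetric] G_inv)
  then have "(?H - Diag y) ** ?V = mat 1" by (rule matrix_left_right_inverse1)
  then have "matrix_inv (?H - Diag y) = ?V" by (rule matrix_inv_unique)
  then show ?thesis by (simp add: grad_matrix_def[of ?H] transpose_mat)
qed

text \<open>
Equal gradients on a convex domain leave only a constant, and \<open>0\<close> lies in the domain.
\<close>

lemma zeta_reduction:
  assumes y: "y \<in> dom_zeta C A"
  shows "zeta C A y = zeta (matrix_inv G) (mat 1) y - ln (det C * det G)"
proof -
  let ?S = "dom_zeta C A" and ?H = "matrix_inv G"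
  let ?\<Delta> = "\<lambda>y. zeta C A y - zeta ?H (mat 1) y"
  have symC: "transpose C = C" using C by (simp add: pos_def_def)
  have "(?\<Delta> has_derivative (\<lambda>h. 0)) (at y within ?S)" if "y \<in> ?S" for y
  proof -
    have "y \<in> dom_zeta ?H (mat 1)" using that dom_zeta_reduction by simp
    from has_derivative_diff[OF has_derivative_zeta[OF that] has_derivative_zeta[OF this]]
    have "(?\<Delta> has_derivative (\<lambda>h. 0)) (at y)"
      by (simp add: grad_matrix_reduction[OF that])
    then show ?thesis by (rule has_derivative_at_withinI)
  qed
  then have "\<exists>c. \<forall>y\<in>?S. ?\<Delta> y = c"
    using has_derivative_zero_constant[OF convex_dom_zeta[OF symC], of A ?\<Delta>] by simp
  then obtain c where c: "\<And>y. y \<in> ?S \<Longrightarrow> ?\<Delta> y = c" by blast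
  have slack0: "M - transpose B ** Diag 0 ** B = M" for M :: "real^'k^'k" and B :: "real^'k^'l"
    using linear_0[OF bounded_linear.linear[OF bounded_linear_congruence_Diag]] by simp
  have "0 \<in> ?S" using C by (simp add: dom_zeta_def slack0)
  have "0 < det C" "0 < det G" using C pos_def_weighted_gram pos_def_det_pos by auto
  have "det G * det ?H = 1"
    using matrix_inv_inverse(1)[OF pos_def_invertible[OF pos_def_weighted_gram]] by (simp flip: det_mul)
  then have "det ?H = inverse (det G)" using \<open>0 < det G\<close> by (simp add: field_simps)
  then have ln_det_H: "ln (det ?H) = - ln (det G)" using \<open>0 < det G\<close> by (simp add: ln_inverse)
  have zeta_0: "zeta M B 0 = - ln (det M)" for M :: "real^'k^'k" and B :: "real^'k^'l"
    by (simp only: zeta_def slack0)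
  have "c = - ln (det C) - ln (det G)"
    using c[OF \<open>0 \<in> ?S\<close>] unfolding zeta_0 ln_det_H by simp
  also have "\<dots> = - ln (det C * det G)"
    using \<open>0 < det C\<close> \<open>0 < det G\<close> by (simp add: ln_mult)
  finally show ?thesis using c[OF y] by simp
qed

end

theorem lemma15:
  fixes C :: "real^'n^'n" and A :: "real^'n^'m"
    and G :: "real^'m^'m" and \<sigma> \<gamma> :: real
  assumes "pos_def C"
    and "CARD('m) < CARD('n)"
    and "rank A = CARD('m)"
    and "G = A ** matrix_inv C ** transpose A"
    and "\<sigma> = det C"
    and "\<gamma> = det G"
  shows "invertible G \<and> 0 < \<sigma> * \<gamma>
    \<and> dom_zeta C A = {y. Diag y \<prec>\<^sub>L matrix_inv G}
    \<and> (\<forall>y \<in> dom_zeta C A. zeta C A y = - ln (det (matrix_inv G - Diag y)) - ln (\<sigma> * \<gamma>))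
    \<and> self_concordant_barrier (dom_zeta C A) (zeta C A) (real CARD('m))
    \<and> (\<forall>(F :: real^'m \<Rightarrow> real) \<nu>.
          self_concordant_barrier (dom_zeta C A) F \<nu> \<longrightarrow> real CARD('m) \<le> \<nu>)"
proof (intro conjI ballI allI impI)
  note data = assms(1,3,4)
  have G: "pos_def G" by (rule pos_def_weighted_gram[OF data])
  show "invertible G" by (rule pos_def_invertible[OF G])
  show "0 < \<sigma> * \<gamma>" using pos_def_det_pos[OF assms(1)] pos_def_det_pos[OF G] by (simp add: assms(5,6))
  show "dom_zeta C A = {y. Diag y \<prec>\<^sub>L matrix_inv G}"
    unfolding dom_zeta_reduction[OF data] by (rule dom_zeta_mat_1)
  show "zeta C A y = - ln (det (matrix_inv G - Diag y)) - ln (\<sigma> * \<gamma>)" if "y \<in> dom_zeta C A" for y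
    using zeta_reduction[OF data that] by (simp add: zeta_mat_1 assms(5,6))
  show "self_concordant_barrier (dom_zeta C A) (zeta C A) (real CARD('m))"
    using assms(1) by (intro zeta_self_concordant_barrier) (simp add: pos_def_def)
  show "real CARD('m) \<le> \<nu>" if "self_concordant_barrier (dom_zeta C A) F \<nu>" for F \<nu>
    using that barrier_parameter_dom_zeta_mat_1[OF pos_def_matrix_inv[OF G]]
    unfolding dom_zeta_reduction[OF data] by blast
qed

end
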